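(* Let $\pi_1,\pi_2,\pi_3:\mathbb R^2\to\mathbb R$ be pairwise linearly independent linear maps, and for each $j$ let $v_j\in\mathbb R^2$ be a unit vector with $\pi_j(v_j)=0$. Put $D_{\boldsymbol\pi^\perp}=\prod_{j=1}^3 (v_j\cdot\nabla)$. Let $a\in C_c^\infty(\mathbb R^2)$ be supported in a (bounded) neighborhood of $0$, and let $S$ be a real-valued smooth function on a neighborhood of $\mathrm{Conv}(\mathrm{supp}(a))$ (the convex hull of the support of $a$) such that $$|D_{\boldsymbol\pi^\perp}S(x,y)|\ge 1\quad\text{for all }(x,y)\in\mathrm{Conv}(\mathrm{supp}(a)).$$ For $\lambda\in\mathbb R\setminus\{0\}$ and $f_1,f_2,f_3\in L^2(\mathbb R)$ define $$\Lambda_{S,\boldsymbol\pi}(f_1,f_2,f_3)=\iint e^{i\lambda S(x,y)}a(x,y)\prod_{j=1}^3 f_j(\pi_j(x,y))\,dx\,dy.$$ Then there is a constant $C$ (depending on $a,S,\boldsymbol\pi$ but not on $\lambda$ or the $f_j$) such that $$|\Lambda_{S,\boldsymbol\pi}(f_1,f_2,f_3)|\le C|\lambda|^{-1/6}\prod_{j=1}^3\|f_j\|_{L^2(\mathbb R)}.$$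
   Context: $\mathrm{Conv}(X)$ denotes the convex hull of $X\subset\mathbb R^2$. The operator $v\cdot\nabla$ is the directional derivative in direction $v$. *)

theory Defs
  imports "HOL-Analysis.Analysis"
begin

type_synonym R2 = "real \<times> real"

definition dirD :: "R2 \<Rightarrow> (R2 \<Rightarrow> 'b::real_normed_vector) \<Rightarrow> R2 \<Rightarrow> 'b" where
  "dirD v f x = frechet_derivative f (at x) v"

fun dirDs :: "R2 list \<Rightarrow> (R2 \<Rightarrow> 'b::real_normed_vector) \<Rightarrow> R2 \<Rightarrow> 'b" where
  "dirDs [] f = f"
| "dirDs (v # vs) f = dirD v (dirDs vs f)"

definition smooth_on :: "R2 set \<Rightarrow> (R2 \<Rightarrow> 'b::real_normed_vector) \<Rightarrow> bool" where
  "smooth_on U f \<longleftrightarrow> open U \<and>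
     (\<forall>vs. continuous_on U (dirDs vs f) \<and> (\<forall>x\<in>U. dirDs vs f differentiable (at x)))"

definition supp :: "(R2 \<Rightarrow> 'b::zero) \<Rightarrow> R2 set" where
  "supp a = closure {x. a x \<noteq> 0}"

definition Cc_inf :: "(R2 \<Rightarrow> 'b::real_normed_vector) \<Rightarrow> bool" where
  "Cc_inf a \<longleftrightarrow> smooth_on UNIV a \<and> compact (supp a)"

definition L2 :: "(real \<Rightarrow> complex) set" where
  "L2 = {f. f \<in> borel_measurable lborel \<and> integrable lborel (\<lambda>t. (cmod (f t))\<^sup>2)}"

definition L2norm :: "(real \<Rightarrow> complex) \<Rightarrow> real" where
  "L2norm f = sqrt (\<integral>t. (cmod (f t))\<^sup>2 \<partial>lborel)"

definition lin_indep2 :: "(R2 \<Rightarrow> real) \<Rightarrow> (R2 \<Rightarrow> real) \<Rightarrow> bool" where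
  "lin_indep2 p q \<longleftrightarrow> (\<forall>c d. (\<forall>x. c * p x + d * q x = 0) \<longrightarrow> c = 0 \<and> d = 0)"

definition Lambda ::
  "real \<Rightarrow> (R2 \<Rightarrow> real) \<Rightarrow> (R2 \<Rightarrow> complex) \<Rightarrow> (R2 \<Rightarrow> real) \<Rightarrow> (R2 \<Rightarrow> real) \<Rightarrow> (R2 \<Rightarrow> real)
   \<Rightarrow> (real \<Rightarrow> complex) \<Rightarrow> (real \<Rightarrow> complex) \<Rightarrow> (real \<Rightarrow> complex) \<Rightarrow> complex" where
  "Lambda lam S a p1 p2 p3 f1 f2 f3 =
     (\<integral>z. exp (\<i> * of_real (lam * S z)) * a z * f1 (p1 z) * f2 (p2 z) * f3 (p3 z) \<partial>lborel)"

end

theory Submission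
  imports Defs "HOL-Probability.Sinc_Integral"
begin

text \<open>
  In coordinates $z = x w_2 + y w_3$ with $w_j$ parallel to $v_j$ and $\pi_1 w_2 = \pi_1 w_3 = 1$,
  the form is $\iint e^{i\lambda S} a\, f(x) g(y) h(x + y)$. Cauchy--Schwarz in $x + y$ and the
  substitution $(x', y') = (x + t, y - t)$ bound its square by $\|h\|^2 \int |I(t)|\,dt$, where
  $I(t)$ is a bilinear form in $f(x) \bar f(x + t)$ and $g(y) \bar g(y - t)$ with phase
  $\lambda (S(z) - S(z + t w_1))$ and $w_1 = w_2 - w_3$ parallel to $v_1$. Trivially
  $|I(t)| \lesssim \|f\|^2 \|g\|^2$. A second $TT^*$ argument leads to phases that are second
  differences of $S$ with steps $s w_2$ and $t w_1$; on the convex hull of the support the mean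
  value theorem makes their derivative along $w_3$ at least of size $|\lambda s t|$, so two
  integrations by parts and Schur's test yield
  $|I(t)| \lesssim |\lambda t|^{-1/2} \|f \bar f(\cdot + t)\| \|g \bar g(\cdot - t)\|$.
  Using the first bound for $|t| \le |\lambda|^{-1/3}$ and the second one otherwise gives
  $|\lambda|^{-1/3}$ for the square.
\<close>

section \<open>Bounded functions with bounded support\<close>

text \<open>Each Cauchy--Schwarz step discards one function and differences the phase in the
  direction which that function does not see: first \<open>v1\<close>, then \<open>v2\<close>. The
  remaining variable runs along \<open>v3\<close>, so the hypothesis on the third-order derivative
  is exactly what bounds the derivative of the final phase from below. The obstacle is that for a
  single t the L2 norm of f(x) cnj (f(x + t)) is not controlled by the L2 norm of f (t = 0 gives the
  fourth power of f). Only an average is: by Fubini the integral over t of its square is the fourth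
  power of the norm of f. Hence the decaying bound becomes useful only after integration in t, with
  its factor taken out at the smallest admissible t. That factor blows up at t = 0, which forces the
  cut at some \<delta>; balancing \<delta> against (|\<lambda>| \<delta>)^(-1/2) gives \<delta> =
  |\<lambda>|^(-1/3).\<close>

lemma borel_measurable_cnj [measurable (raw)]:
  "f \<in> borel_measurable M \<Longrightarrow> (\<lambda>x. cnj (f x)) \<in> borel_measurable M"
  by (rule borel_measurable_continuous_on[of cnj]) (auto intro: continuous_intros)

text \<open>Domination alone gives the bound: a non-integrable \<open>f\<close> has integral 0 by
  convention, while \<open>g\<close> is nonnegative. Iterated integrals can thus be estimated
  directly, without a measurability argument for the inner one.\<close>

lemma norm_integral_le:
  fixes f :: "'a \<Rightarrow> 'b::{banach,second_countable_topology}"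
  assumes "integrable M g" "\<And>x. norm (f x) \<le> g x"
  shows "norm (integral\<^sup>L M f) \<le> integral\<^sup>L M g"
proof (cases "integrable M f")
  case True
  have "norm (integral\<^sup>L M f) \<le> (\<integral>x. norm (f x) \<partial>M)" by (rule integral_norm_bound)
  also have "\<dots> \<le> integral\<^sup>L M g" using True assms by (intro integral_mono) auto
  finally show ?thesis .
next
  case False
  have "0 \<le> integral\<^sup>L M g"
    using assms(2) norm_ge_zero order_trans by (intro Bochner_Integration.integral_nonneg) blast
  then show ?thesis using False by (simp add: not_integrable_integral_eq)
qed

text \<open>A class in which Fubini always applies: it is stable under bounded factors, sections,
  partial integrals and correlations. General L2 data are reached from it by truncation at the
  end.\<close>

definition bbs :: "('a::euclidean_space \<Rightarrow> complex) \<Rightarrow> bool" where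
  "bbs f \<longleftrightarrow> f \<in> borel_measurable borel \<and> bounded (range f) \<and> bounded {x. f x \<noteq> 0}"

lemma bbsI:
  assumes "f \<in> borel_measurable borel" "\<And>x. norm (f x) \<le> M" "\<And>x. f x \<noteq> 0 \<Longrightarrow> norm x \<le> R"
  shows "bbs f"
  using assms unfolding bbs_def bounded_iff by blast

lemma bbsE:
  assumes "bbs f"
  obtains M R where "f \<in> borel_measurable borel" "M \<ge> 0" "R \<ge> 0" "\<And>x. norm (f x) \<le> M"
    "\<And>x. f x \<noteq> 0 \<Longrightarrow> norm x \<le> R"
proof -
  from assms obtain M R where *: "\<And>x. norm (f x) \<le> M" "\<And>x. f x \<noteq> 0 \<Longrightarrow> norm x \<le> R"
    unfolding bbs_def bounded_iff by blast
  show thesis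
    by (rule that[of "max M 0" "max R 0"]) (use assms * in \<open>auto simp: bbs_def le_max_iff_disj\<close>)
qed

lemma bbs_measurable: "bbs f \<Longrightarrow> f \<in> borel_measurable borel"
  by (simp add: bbs_def)

lemma bbs_integrable:
  assumes "bbs f" shows "integrable lborel f"
proof -
  obtain M R where *: "f \<in> borel_measurable borel" "\<And>x. norm (f x) \<le> M"
    "\<And>x. f x \<noteq> 0 \<Longrightarrow> norm x \<le> R" using assms by (metis bbsE)
  show ?thesis
    by (rule integrableI_bounded_set[where A="cball 0 R" and B=M])
      (use * emeasure_lborel_cball_finite[of 0 R] in \<open>auto simp: dist_norm\<close>)
qed

lemma bbs_mult_bounded:
  assumes "bbs f" "g \<in> borel_measurable borel" "\<And>x. norm (g x) \<le> M"
  shows "bbs (\<lambda>x. f x * g x)"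
proof -
  obtain N R where *: "f \<in> borel_measurable borel" "N \<ge> 0" "\<And>x. norm (f x) \<le> N"
    "\<And>x. f x \<noteq> 0 \<Longrightarrow> norm x \<le> R" using assms by (metis bbsE)
  show ?thesis
    by (rule bbsI[where M="N*M" and R=R])
      (use * assms in \<open>auto simp: norm_mult intro!: mult_mono\<close>)
qed

lemma bbs_section:
  assumes "bbs (f :: 'a::euclidean_space \<times> 'b::euclidean_space \<Rightarrow> complex)"
  shows "bbs (\<lambda>y. f (x, y))"
proof -
  obtain N R where *[measurable]: "f \<in> borel_measurable borel" and **: "N \<ge> 0" "\<And>x. norm (f x) \<le> N"
    "\<And>x. f x \<noteq> 0 \<Longrightarrow> norm x \<le> R" using assms by (metis bbsE)
  show ?thesis
  proof (rule bbsI[where M="N" and R=R])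
    show "f (x,y) \<noteq> 0 \<Longrightarrow> norm y \<le> R" for y
      using **(3)[of "(x,y)"] norm_snd_le[of y x] by linarith
  qed (use ** in auto)
qed

lemma bbs_swap:
  assumes "bbs (f :: 'a::euclidean_space \<times> 'b::euclidean_space \<Rightarrow> complex)"
  shows "bbs (\<lambda>(y, x). f (x, y))"
proof -
  obtain N R where *[measurable]: "f \<in> borel_measurable borel" and **: "N \<ge> 0" "\<And>x. norm (f x) \<le> N"
    "\<And>x. f x \<noteq> 0 \<Longrightarrow> norm x \<le> R" using assms by (metis bbsE)
  show ?thesis
  proof (rule bbsI[where M="N" and R=R])
    show "(\<lambda>(y, x). f (x, y)) \<in> borel_measurable borel"
      by (simp add: case_prod_beta' borel_prod[symmetric])
  qed (use ** in \<open>auto simp: norm_Pair add.commute\<close>)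
qed

lemma bbs_iterated:
  assumes "bbs (f :: 'a::euclidean_space \<times> 'b::euclidean_space \<Rightarrow> complex)"
  shows bbs_integral: "(\<integral>x. (\<integral>y. f (x, y) \<partial>lborel) \<partial>lborel) = integral\<^sup>L lborel f"
    and bbs_integral': "(\<integral>y. (\<integral>x. f (x, y) \<partial>lborel) \<partial>lborel) = integral\<^sup>L lborel f"
proof -
  have "integrable (lborel \<Otimes>\<^sub>M lborel) f"
    using bbs_integrable[OF assms] by (simp add: lborel_prod)
  then show "(\<integral>x. (\<integral>y. f (x, y) \<partial>lborel) \<partial>lborel) = integral\<^sup>L lborel f"
    and "(\<integral>y. (\<integral>x. f (x, y) \<partial>lborel) \<partial>lborel) = integral\<^sup>L lborel f"
    using lborel_pair.integral_fst'[of f] lborel_pair.integral_snd[of "curry f"]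
    by (simp_all add: lborel_prod)
qed

lemma bbs_partial_integral:
  assumes "bbs (f :: 'a::euclidean_space \<times> 'b::euclidean_space \<Rightarrow> complex)"
  shows "bbs (\<lambda>x. \<integral>y. f (x, y) \<partial>lborel)"
proof -
  obtain N R where *: "f \<in> borel_measurable borel" and **: "N \<ge> 0" "R \<ge> 0" "\<And>x. norm (f x) \<le> N"
    "\<And>x. f x \<noteq> 0 \<Longrightarrow> norm x \<le> R" using assms by (metis bbsE)
  have [measurable]: "f \<in> borel_measurable (borel \<Otimes>\<^sub>M borel)" using * by (simp add: borel_prod)
  have z: "f (x, y) = 0" if "norm x > R \<or> norm y > R" for x y
    using **(4)[of "(x,y)"] norm_snd_le[of y x] norm_fst_le[of x y] that by fastforce
  show ?thesis
  proof (rule bbsI[where M="N * measure lborel (cball (0::'b) R)" and R=R])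
    show "(\<lambda>x. \<integral>y. f (x, y) \<partial>lborel) \<in> borel_measurable borel"
      by measurable
    fix x
    have "norm (\<integral>y. f (x, y) \<partial>lborel) \<le> (\<integral>y. N * indicator (cball 0 R) (y::'b) \<partial>lborel)"
    proof (rule norm_integral_le)
      show "integrable lborel (\<lambda>y::'b. N * indicator (cball 0 R) y)"
        using emeasure_lborel_cball_finite[of "0::'b" R] by (intro integrable_mult_right) auto
      show "norm (f (x, y)) \<le> N * indicator (cball 0 R) y" for y
        using z[of x y] ** by (auto simp: indicator_def dist_norm not_le)
    qed
    also have "\<dots> = N * measure lborel (cball (0::'b) R)"
      by simp
    finally show "norm (\<integral>y. f (x, y) \<partial>lborel) \<le> N * measure lborel (cball (0::'b) R)" .
    show "(\<integral>y. f (x, y) \<partial>lborel) \<noteq> 0 \<Longrightarrow> norm x \<le> R"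
      using z[of x] by (metis Bochner_Integration.integral_cong integral_zero not_le)
  qed
qed

section \<open>Translations and correlations\<close>

lemma integral_shift:
  fixes f :: "real \<Rightarrow> 'a::{banach,second_countable_topology}"
  shows "(\<integral>x. f (t + x) \<partial>lborel) = (\<integral>x. f x \<partial>lborel)"
  using lborel_integral_real_affine[of 1 f t] by simp

lemma bbs_correlation:
  fixes k :: "real \<times> real \<Rightarrow> complex"
  assumes "bbs k"
  shows "bbs (\<lambda>p. k (snd (fst p), snd p) * cnj (k (snd (fst p) + fst (fst p), snd p)))"
proof -
  obtain N R where *: "k \<in> borel_measurable borel" and **: "N \<ge> 0" "R \<ge> 0" "\<And>x. norm (k x) \<le> N"
    "\<And>x. k x \<noteq> 0 \<Longrightarrow> norm x \<le> R" using assms by (metis bbsE)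
  have [measurable]: "k \<in> borel_measurable (borel \<Otimes>\<^sub>M borel)" using * by (simp add: borel_prod)
  have z: "\<bar>x\<bar> \<le> R" "\<bar>y\<bar> \<le> R" if "k (x, y) \<noteq> 0" for x y
    using **(4)[of "(x,y)"] norm_snd_le[of y x] norm_fst_le[of x y] that by auto
  show ?thesis
  proof (rule bbsI[where M="N*N" and R="4*R"])
    show "(\<lambda>p. k (snd (fst p), snd p) * cnj (k (snd (fst p) + fst (fst p), snd p))) \<in> borel_measurable borel"
      unfolding borel_prod[symmetric] case_prod_beta' by measurable
    show "norm (k (snd (fst p), snd p) * cnj (k (snd (fst p) + fst (fst p), snd p))) \<le> N*N" for p
      using ** by (auto simp: norm_mult intro!: mult_mono)
    fix p :: "(real \<times> real) \<times> real"
    assume "(k (snd (fst p), snd p) * cnj (k (snd (fst p) + fst (fst p), snd p))) \<noteq> 0"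
    then obtain s x y where p: "p = ((s,x),y)" and nz: "k (x,y) \<noteq> 0" "k (x+s,y) \<noteq> 0"
      by (cases p) force
    have "norm p \<le> (\<bar>s\<bar> + \<bar>x\<bar>) + \<bar>y\<bar>"
      unfolding p using norm_Pair_le[of "(s,x)" y] norm_Pair_le[of s x] by simp
    \<comment> \<open>The shift \<open>s\<close> is the difference of two first coordinates in the
      support, so it is at most \<open>2*R\<close>; \<open>x\<close> and \<open>y\<close> contribute
      \<open>R\<close> each.\<close>
    then show "norm p \<le> 4*R" using z[OF nz(1)] z[OF nz(2)] by linarith
  qed
qed

text \<open>The \<open>TT\<^sup>*\<close> identity, with the two copies of the inner variable written as \<open>x\<close> and \<open>x + s\<close>.\<close>

lemma integral_square_correlation:
  fixes k :: "real \<times> real \<Rightarrow> complex"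
  assumes "bbs k"
  shows "complex_of_real (\<integral>z. (cmod (\<integral>x. k (x,z) \<partial>lborel))\<^sup>2 \<partial>lborel) =
    (\<integral>s. (\<integral>x. (\<integral>z. k (x,z) * cnj (k (x+s,z)) \<partial>lborel) \<partial>lborel) \<partial>lborel)"
proof -
  define T where "T = (\<lambda>p. k (snd (fst p), snd p) * cnj (k (snd (fst p) + fst (fst p), snd p)))"
  have T: "bbs T" unfolding T_def by (rule bbs_correlation[OF assms])
  have Tz: "bbs (\<lambda>p. T (p, z))" for z
    using bbs_section[OF bbs_swap[OF T], of z] by simp
  have "complex_of_real ((cmod (\<integral>x. k (x,z) \<partial>lborel))\<^sup>2) = (\<integral>p. T (p, z) \<partial>lborel)" for z
  proof -
    have "complex_of_real ((cmod (\<integral>x. k (x,z) \<partial>lborel))\<^sup>2) =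
      (\<integral>x. k (x,z) \<partial>lborel) * (\<integral>x. cnj (k (x,z)) \<partial>lborel)"
      by (simp add: complex_norm_square[symmetric] del: of_real_power)
    also have "\<dots> = (\<integral>x. k (x,z) * (\<integral>x. cnj (k (x,z)) \<partial>lborel) \<partial>lborel)"
      by simp
    also have "\<dots> = (\<integral>x. (\<integral>s. T ((s,x),z) \<partial>lborel) \<partial>lborel)"
    proof (rule Bochner_Integration.integral_cong[OF refl])
      fix x
      have "k (x,z) * (\<integral>x. cnj (k (x,z)) \<partial>lborel) = k (x,z) * (\<integral>s. cnj (k (x+s,z)) \<partial>lborel)"
        using integral_shift[of "\<lambda>x. cnj (k (x,z))" x] by simp
      then show "k (x,z) * (\<integral>x. cnj (k (x,z)) \<partial>lborel) = (\<integral>s. T ((s,x),z) \<partial>lborel)"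
        by (simp add: T_def del: complex_cnj_cnj)
    qed
    also have "\<dots> = (\<integral>p. T (p, z) \<partial>lborel)"
      using bbs_integral'[OF Tz[of z]] by simp
    finally show ?thesis .
  qed
  then have "complex_of_real (\<integral>z. (cmod (\<integral>x. k (x,z) \<partial>lborel))\<^sup>2 \<partial>lborel) =
      (\<integral>z. (\<integral>p. T (p, z) \<partial>lborel) \<partial>lborel)"
    by (simp flip: integral_complex_of_real)
  also have "\<dots> = (\<integral>p. (\<integral>z. T (p, z) \<partial>lborel) \<partial>lborel)"
    using bbs_integral[OF T] bbs_integral'[OF T] by simp
  also have "\<dots> = (\<integral>s. (\<integral>x. (\<integral>z. T ((s,x), z) \<partial>lborel) \<partial>lborel) \<partial>lborel)"
    using bbs_integral[OF bbs_partial_integral[OF T]] by simp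
  finally show ?thesis by (simp add: T_def)
qed

lemma bbs_pairI:
  fixes f :: "real \<times> real \<Rightarrow> complex"
  assumes "f \<in> borel_measurable (borel \<Otimes>\<^sub>M borel)" "\<And>x y. norm (f (x,y)) \<le> M"
    "\<And>x y. f (x,y) \<noteq> 0 \<Longrightarrow> \<bar>x\<bar> \<le> R \<and> \<bar>y\<bar> \<le> R'"
  shows "bbs f"
proof (rule bbsI[where M=M and R="R+R'"])
  show "f p \<noteq> 0 \<Longrightarrow> norm p \<le> R + R'" for p
    using assms(3)[of "fst p" "snd p"] norm_Pair_le[of "fst p" "snd p"] by auto
  show "norm (f p) \<le> M" for p using assms(2)[of "fst p" "snd p"] by simp
qed (use assms(1) in \<open>simp add: borel_prod\<close>)

lemma bbs_real_correlation:
  fixes f :: "real \<Rightarrow> complex"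
  assumes "bbs f"
  shows "bbs (\<lambda>x. f x * cnj (f (x + t)))"
proof -
  obtain N R where *[measurable]: "f \<in> borel_measurable borel" and **: "\<And>x. norm (f x) \<le> N"
    using assms by (metis bbsE)
  show ?thesis by (rule bbs_mult_bounded[OF assms, where M=N]) (use ** in auto)
qed

lemma bbs_square_integrable:
  assumes "bbs f" shows "integrable lborel (\<lambda>x. (cmod (f x))\<^sup>2)"
proof -
  obtain N where *[measurable]: "f \<in> borel_measurable borel" and **: "\<And>x. norm (f x) \<le> N"
    using assms by (metis bbsE)
  have "bbs (\<lambda>x. f x * cnj (f x))"
    by (rule bbs_mult_bounded[OF assms, where M=N]) (use ** in auto)
  then have "integrable lborel (\<lambda>x. norm (f x * cnj (f x)))"
    using bbs_integrable integrable_norm by blast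
  then show ?thesis by (simp add: norm_mult power2_eq_square)
qed

section \<open>The L2 norm and the Cauchy--Schwarz inequality\<close>

lemma L2norm_nonneg [simp]: "0 \<le> L2norm f"
  by (simp add: L2norm_def)

lemma L2norm_square: "(L2norm f)\<^sup>2 = (\<integral>t. (cmod (f t))\<^sup>2 \<partial>lborel)"
  by (simp add: L2norm_def)

lemma L2norm_shift: "L2norm (\<lambda>x. f (x + t)) = L2norm f"
  unfolding L2norm_def using integral_shift[of "\<lambda>x. (cmod (f x))\<^sup>2" t] by (simp add: add.commute)

lemma L2_Cauchy_Schwarz:
  assumes [measurable]: "u \<in> borel_measurable borel" "v \<in> borel_measurable borel"
    and u: "integrable lborel (\<lambda>x. (cmod (u x))\<^sup>2)" and v: "integrable lborel (\<lambda>x. (cmod (v x))\<^sup>2)"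
  shows L2_integrable_mult: "integrable lborel (\<lambda>x. cmod (u x) * cmod (v x))"
    and "(\<integral>x. cmod (u x) * cmod (v x) \<partial>lborel) \<le> L2norm u * L2norm v"
    and "cmod (\<integral>x. u x * v x \<partial>lborel) \<le> L2norm u * L2norm v"
proof -
  show i: "integrable lborel (\<lambda>x. cmod (u x) * cmod (v x))"
  proof (rule Bochner_Integration.integrable_bound)
    show "integrable lborel (\<lambda>x. (cmod (u x))\<^sup>2 + (cmod (v x))\<^sup>2)" using u v by simp
    have "\<bar>a * b\<bar> \<le> a\<^sup>2 + b\<^sup>2" for a b :: real
      using sum_squares_bound[of "\<bar>a\<bar>" "\<bar>b\<bar>"] mult_nonneg_nonneg[OF abs_ge_zero[of a] abs_ge_zero[of b]]
      unfolding abs_mult power2_abs by linarith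
    from this[of "cmod (u _)" "cmod (v _)"]
    show "AE x in lborel. norm (cmod (u x) * cmod (v x)) \<le> norm ((cmod (u x))\<^sup>2 + (cmod (v x))\<^sup>2)"
      by (auto intro!: AE_I2 simp: abs_mult)
  qed simp
  have "(\<integral>\<^sup>+x. ennreal (cmod (u x)) * ennreal (cmod (v x)) \<partial>lborel)\<^sup>2
      \<le> (\<integral>\<^sup>+x. (ennreal (cmod (u x)))\<^sup>2 \<partial>lborel) * (\<integral>\<^sup>+x. (ennreal (cmod (v x)))\<^sup>2 \<partial>lborel)"
    by (rule Cauchy_Schwarz_nn_integral) auto
  then have "ennreal ((\<integral>x. cmod (u x) * cmod (v x) \<partial>lborel)\<^sup>2) \<le>
      ennreal ((\<integral>x. (cmod (u x))\<^sup>2 \<partial>lborel) * (\<integral>x. (cmod (v x))\<^sup>2 \<partial>lborel))"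
    using i u v
    by (simp add: ennreal_power ennreal_mult[symmetric] nn_integral_eq_integral)
  then have "(\<integral>x. cmod (u x) * cmod (v x) \<partial>lborel)\<^sup>2 \<le> (L2norm u * L2norm v)\<^sup>2"
    by (simp add: power_mult_distrib L2norm_square)
  then show c: "(\<integral>x. cmod (u x) * cmod (v x) \<partial>lborel) \<le> L2norm u * L2norm v"
    by (rule power2_le_imp_le) simp
  have "cmod (\<integral>x. u x * v x \<partial>lborel) \<le> (\<integral>x. cmod (u x) * cmod (v x) \<partial>lborel)"
    by (rule norm_integral_le[OF i]) (simp add: norm_mult)
  with c show "cmod (\<integral>x. u x * v x \<partial>lborel) \<le> L2norm u * L2norm v" by simp
qed

lemma bbs_Cauchy_Schwarz:
  assumes "bbs u" "bbs v"
  shows "integrable lborel (\<lambda>x. cmod (u x) * cmod (v x))"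
    and "(\<integral>x. cmod (u x) * cmod (v x) \<partial>lborel) \<le> L2norm u * L2norm v"
    and "cmod (\<integral>x. u x * v x \<partial>lborel) \<le> L2norm u * L2norm v"
  using L2_Cauchy_Schwarz[OF bbs_measurable[OF assms(1)] bbs_measurable[OF assms(2)]
      bbs_square_integrable[OF assms(1)] bbs_square_integrable[OF assms(2)]] by auto

lemma bbs_shift:
  fixes f :: "real \<Rightarrow> complex"
  assumes "bbs f" shows "bbs (\<lambda>x. f (x + t))"
proof -
  obtain N R where *[measurable]: "f \<in> borel_measurable borel" and **: "\<And>x. norm (f x) \<le> N"
    "\<And>x. f x \<noteq> 0 \<Longrightarrow> norm x \<le> R" using assms by (metis bbsE)
  show ?thesis
  proof (rule bbsI[where M=N and R="R+\<bar>t\<bar>"])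
    show "f (x + t) \<noteq> 0 \<Longrightarrow> norm x \<le> R + \<bar>t\<bar>" for x using **(2)[of "x+t"] by auto
  qed (use ** in auto)
qed

text \<open>Cauchy--Schwarz and translation invariance give an L1 bound uniform in the shift. It
  serves both the trivial estimate of I(t) and the Schur-type estimate.\<close>

lemma bbs_correlation_L1:
  fixes f :: "real \<Rightarrow> complex"
  assumes "bbs f"
  shows "integrable lborel (\<lambda>x. cmod (f x) * cmod (f (x + t)))"
    and "(\<integral>x. cmod (f x) * cmod (f (x + t)) \<partial>lborel) \<le> (L2norm f)\<^sup>2"
  using bbs_Cauchy_Schwarz(1,2)[OF assms bbs_shift[OF assms, of t]]
  by (simp_all add: power2_eq_square L2norm_shift)

section \<open>Bilinear and trilinear estimates from kernel decay\<close>

lemma integral_Cauchy_kernel: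
  assumes "\<mu> > 0"
  shows "integrable lborel (\<lambda>s. 1 / (1 + (\<mu> * s)\<^sup>2))"
    and "(\<integral>s. 1 / (1 + (\<mu> * s)\<^sup>2) \<partial>lborel) = pi / \<mu>"
proof -
  have 1: "integrable lborel (\<lambda>x::real. 1 / (1 + x\<^sup>2))"
    using integrable_inverse_1_plus_square
    by (simp add: set_integrable_def einterval_eq_UNIV inverse_eq_divide)
  have 2: "(\<integral>x. 1 / (1 + x\<^sup>2) \<partial>lborel) = pi"
    using LBINT_inverse_1_plus_square
    by (simp add: interval_lebesgue_integral_def set_lebesgue_integral_def einterval_eq_UNIV inverse_eq_divide)
  show "integrable lborel (\<lambda>s. 1 / (1 + (\<mu> * s)\<^sup>2))"
    using lborel_integrable_real_affine[OF 1, of \<mu> 0] assms by simp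
  show "(\<integral>s. 1 / (1 + (\<mu> * s)\<^sup>2) \<partial>lborel) = pi / \<mu>"
    using lborel_integral_real_affine[of \<mu> "\<lambda>x. 1 / (1 + x\<^sup>2)" 0] 2 assms by (simp add: field_simps)
qed

text \<open>Cauchy--Schwarz in y separates \<open>G\<close>. By the correlation identity the squared
  norm of the remaining factor is an integral of F(x) cnj (F(x + s)) against the kernel. Since the
  correlation of \<open>F\<close> has L1 norm at most \<open>(L2norm F)\<^sup>2\<close> for every
  \<open>s\<close>, the kernel may be integrated in \<open>s\<close> on its own, with total mass
  \<open>C * pi / \<mu>\<close>.\<close>

lemma oscillatory_form_L2_bound:
  fixes b :: "real \<times> real \<Rightarrow> complex" and F G :: "real \<Rightarrow> complex"
  assumes b: "bbs b" and F: "bbs F" and G: "bbs G" and C: "C \<ge> 0" and \<mu>: "\<mu> > 0"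
    and kernel: "\<And>x s. cmod (\<integral>y. b (x,y) * cnj (b (x+s,y)) \<partial>lborel) \<le> C / (1 + (\<mu> * s)\<^sup>2)"
  shows "cmod (\<integral>x. (\<integral>y. b (x,y) * F x * G y \<partial>lborel) \<partial>lborel) \<le> sqrt (C * pi / \<mu>) * L2norm F * L2norm G"
proof -
  define k where "k = (\<lambda>p. b p * F (fst p))"
  obtain NF where [measurable]: "F \<in> borel_measurable borel" and NF: "\<And>x. norm (F x) \<le> NF"
    using F by (metis bbsE)
  obtain NG where [measurable]: "G \<in> borel_measurable borel" and NG: "\<And>x. norm (G x) \<le> NG"
    using G by (metis bbsE)
  have k: "bbs k" unfolding k_def
    by (rule bbs_mult_bounded[OF b, where M=NF]) (auto simp: borel_prod[symmetric] NF)
  have kG: "bbs (\<lambda>p. k p * G (snd p))"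
    by (rule bbs_mult_bounded[OF k, where M=NG]) (auto simp: borel_prod[symmetric] NG)
  define H where "H = (\<lambda>y. \<integral>x. k (x,y) \<partial>lborel)"
  have H: "bbs H" unfolding H_def using bbs_partial_integral[OF bbs_swap[OF k]] by simp
  have "(\<integral>x. (\<integral>y. b (x,y) * F x * G y \<partial>lborel) \<partial>lborel) = (\<integral>x. (\<integral>y. k (x,y) * G y \<partial>lborel) \<partial>lborel)"
    by (simp add: k_def)
  also have "\<dots> = (\<integral>y. (\<integral>x. k (x,y) * G y \<partial>lborel) \<partial>lborel)"
    using bbs_iterated[OF kG] by simp
  also have "\<dots> = (\<integral>y. H y * G y \<partial>lborel)" by (simp add: H_def)
  finally have 1: "cmod (\<integral>x. (\<integral>y. b (x,y) * F x * G y \<partial>lborel) \<partial>lborel) \<le> L2norm H * L2norm G"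
    using bbs_Cauchy_Schwarz(3)[OF H G] by simp
  have "(L2norm H)\<^sup>2 = cmod (complex_of_real (\<integral>y. (cmod (H y))\<^sup>2 \<partial>lborel))"
    by (simp add: L2norm_square)
  also have "\<dots> = cmod (\<integral>s. (\<integral>x. (\<integral>y. k (x,y) * cnj (k (x+s,y)) \<partial>lborel) \<partial>lborel) \<partial>lborel)"
    using integral_square_correlation[OF k] by (simp add: H_def)
  also have "\<dots> \<le> (\<integral>s. (C * (L2norm F)\<^sup>2) * (1 / (1 + (\<mu> * s)\<^sup>2)) \<partial>lborel)"
  proof (rule norm_integral_le)
    show "integrable lborel (\<lambda>s. (C * (L2norm F)\<^sup>2) * (1 / (1 + (\<mu> * s)\<^sup>2)))"
      by (intro integrable_mult_right integral_Cauchy_kernel \<mu>)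
    fix s
    have "cmod (\<integral>x. (\<integral>y. k (x,y) * cnj (k (x+s,y)) \<partial>lborel) \<partial>lborel) \<le>
      (\<integral>x. cmod (F x) * cmod (F (x+s)) * (C / (1 + (\<mu> * s)\<^sup>2)) \<partial>lborel)"
    proof (rule norm_integral_le)
      show "integrable lborel (\<lambda>x. cmod (F x) * cmod (F (x+s)) * (C / (1 + (\<mu> * s)\<^sup>2)))"
        by (intro integrable_mult_left bbs_correlation_L1 F)
      fix x
      have "(\<integral>y. k (x,y) * cnj (k (x+s,y)) \<partial>lborel) =
        (\<integral>y. (F x * cnj (F (x+s))) * (b (x,y) * cnj (b (x+s,y))) \<partial>lborel)"
        by (simp add: k_def mult_ac)
      then have "cmod (\<integral>y. k (x,y) * cnj (k (x+s,y)) \<partial>lborel) =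
        cmod (F x) * cmod (F (x+s)) * cmod (\<integral>y. b (x,y) * cnj (b (x+s,y)) \<partial>lborel)"
        by (simp add: norm_mult)
      also have "\<dots> \<le> cmod (F x) * cmod (F (x+s)) * (C / (1 + (\<mu> * s)\<^sup>2))"
        by (rule mult_left_mono[OF kernel]) simp
      finally show "cmod (\<integral>y. k (x,y) * cnj (k (x+s,y)) \<partial>lborel) \<le>
        cmod (F x) * cmod (F (x+s)) * (C / (1 + (\<mu> * s)\<^sup>2))" .
    qed
    also have "\<dots> = (\<integral>x. cmod (F x) * cmod (F (x+s)) \<partial>lborel) * (C / (1 + (\<mu> * s)\<^sup>2))"
      by (rule Bochner_Integration.integral_mult_left) (intro bbs_correlation_L1 F)
    also have "\<dots> \<le> (L2norm F)\<^sup>2 * (C / (1 + (\<mu> * s)\<^sup>2))"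
      using C by (intro mult_right_mono bbs_correlation_L1 F) (simp add: add_nonneg_nonneg)
    finally show "cmod (\<integral>x. (\<integral>y. k (x,y) * cnj (k (x+s,y)) \<partial>lborel) \<partial>lborel) \<le>
      (C * (L2norm F)\<^sup>2) * (1 / (1 + (\<mu> * s)\<^sup>2))"
      by (simp add: mult_ac)
  qed
  also have "\<dots> = (C * (L2norm F)\<^sup>2) * (pi / \<mu>)"
    by (subst Bochner_Integration.integral_mult_right) (simp_all add: integral_Cauchy_kernel \<mu>)
  finally have "(L2norm H)\<^sup>2 \<le> (C * pi / \<mu>) * (L2norm F)\<^sup>2" by (simp add: mult_ac)
  then have "sqrt ((L2norm H)\<^sup>2) \<le> sqrt ((C * pi / \<mu>) * (L2norm F)\<^sup>2)"
    by (rule real_sqrt_le_mono)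
  then have "L2norm H \<le> sqrt (C * pi / \<mu>) * L2norm F"
    by (simp only: real_sqrt_mult real_sqrt_abs abs_of_nonneg[OF L2norm_nonneg])
  then have "L2norm H * L2norm G \<le> sqrt (C * pi / \<mu>) * L2norm F * L2norm G"
    by (rule mult_right_mono) simp
  with 1 show ?thesis by simp
qed

text \<open>With the order of integration exchanged, the t-integral of |f(x + t)|^2 is the same for
  every x, so the double integral factors.\<close>

lemma L2norm_correlation:
  fixes f :: "real \<Rightarrow> complex"
  assumes f: "bbs f"
  defines "N \<equiv> \<lambda>t. L2norm (\<lambda>x. f x * cnj (f (x + t)))"
  shows "N \<in> borel_measurable borel" "integrable lborel (\<lambda>t. (N t)\<^sup>2)"
    "(\<integral>t. (N t)\<^sup>2 \<partial>lborel) = (L2norm f) ^ 4"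
proof -
  define T where "T = (\<lambda>p. complex_of_real ((cmod (f (snd p)))\<^sup>2 * (cmod (f (snd p + fst p)))\<^sup>2))"
  obtain B R where [measurable]: "f \<in> borel_measurable borel" and B: "B \<ge> 0" "\<And>x. norm (f x) \<le> B"
    and R: "\<And>x. f x \<noteq> 0 \<Longrightarrow> norm x \<le> R"
    using f by (metis bbsE)
  have T: "bbs T"
  proof (rule bbs_pairI[where M="B\<^sup>2*B\<^sup>2" and R="R+R" and R'=R])
    show "T \<in> borel_measurable (borel \<Otimes>\<^sub>M borel)" unfolding T_def by measurable
    show "norm (T (x,y)) \<le> B\<^sup>2*B\<^sup>2" for x y
      unfolding T_def norm_of_real using B by (auto simp: abs_mult simp del: power_add_numeral intro!: mult_mono power_mono)
    show "T (x,y) \<noteq> 0 \<Longrightarrow> \<bar>x\<bar> \<le> R+R \<and> \<bar>y\<bar> \<le> R" for x y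
      using R[of y] R[of "y+x"] by (auto simp: T_def)
  qed
  have N2: "complex_of_real ((N t)\<^sup>2) = (\<integral>x. T (t,x) \<partial>lborel)" for t
    by (simp add: N_def L2norm_square T_def norm_mult power_mult_distrib flip: integral_complex_of_real of_real_mult of_real_power)
  have b: "bbs (\<lambda>t. complex_of_real ((N t)\<^sup>2))"
    unfolding N2 by (rule bbs_partial_integral[OF T])
  \<comment> \<open>Only the square of \<open>N t\<close> is a partial integral; measurability of
    \<open>N\<close> itself comes from taking the root.\<close>
  have "(\<lambda>t. sqrt (cmod (complex_of_real ((N t)\<^sup>2)))) \<in> borel_measurable borel"
    using bbs_measurable[OF b] by measurable
  moreover have "sqrt (cmod (complex_of_real ((N t)\<^sup>2))) = N t" for t
    unfolding norm_of_real by (simp add: N_def)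
  ultimately show "N \<in> borel_measurable borel" by simp
  show i: "integrable lborel (\<lambda>t. (N t)\<^sup>2)"
    using bbs_integrable[OF b] by (simp only: complex_of_real_integrable_eq)
  have "complex_of_real (\<integral>t. (N t)\<^sup>2 \<partial>lborel) = (\<integral>t. (\<integral>x. T (t,x) \<partial>lborel) \<partial>lborel)"
    by (simp only: integral_complex_of_real[symmetric] N2)
  also have "\<dots> = (\<integral>x. (\<integral>t. T (t,x) \<partial>lborel) \<partial>lborel)"
    using bbs_iterated[OF T] by simp
  also have "\<dots> = (\<integral>x. complex_of_real ((cmod (f x))\<^sup>2 * (L2norm f)\<^sup>2) \<partial>lborel)"
  proof (rule Bochner_Integration.integral_cong[OF refl])
    fix x
    have "(\<integral>t. T (t,x) \<partial>lborel) = complex_of_real (\<integral>t. (cmod (f x))\<^sup>2 * (cmod (f (x + t)))\<^sup>2 \<partial>lborel)"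
      by (simp only: T_def integral_complex_of_real[symmetric] fst_conv snd_conv)
    also have "\<dots> = complex_of_real ((cmod (f x))\<^sup>2 * (L2norm (\<lambda>t. f (t + x)))\<^sup>2)"
      by (simp add: L2norm_square add.commute)
    finally show "(\<integral>t. T (t,x) \<partial>lborel) = complex_of_real ((cmod (f x))\<^sup>2 * (L2norm f)\<^sup>2)"
      by (simp only: L2norm_shift)
  qed
  also have "\<dots> = complex_of_real (\<integral>x. (cmod (f x))\<^sup>2 * (L2norm f)\<^sup>2 \<partial>lborel)"
    by (rule integral_complex_of_real)
  also have "(\<integral>x. (cmod (f x))\<^sup>2 * (L2norm f)\<^sup>2 \<partial>lborel) = (L2norm f)\<^sup>2 * (L2norm f)\<^sup>2"
    by (simp add: L2norm_square)
  also have "\<dots> = (L2norm f) ^ 4" by (simp add: power2_eq_square power4_eq_xxxx)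
  finally show "(\<integral>t. (N t)\<^sup>2 \<partial>lborel) = (L2norm f) ^ 4" by (simp only: of_real_eq_iff)
qed

text \<open>Cauchy--Schwarz in the shift t. This is the point where the norms of the correlations
  turn back into norms of \<open>f\<close> and \<open>g\<close>.\<close>

lemma integral_L2norm_correlation_le:
  fixes f g :: "real \<Rightarrow> complex"
  assumes f: "bbs f" and g: "bbs g"
  defines "N \<equiv> \<lambda>f t. L2norm (\<lambda>x. f x * cnj (f (x + t)))"
  shows "integrable lborel (\<lambda>t. N f t * N g t)"
    "(\<integral>t. N f t * N g t \<partial>lborel) \<le> (L2norm f)\<^sup>2 * (L2norm g)\<^sup>2"
proof -
  have n: "N f t \<ge> 0" "N g t \<ge> 0" for t by (simp_all add: N_def)
  note c = L2norm_correlation[OF f] L2norm_correlation[OF g]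
  have m: "(\<lambda>t. complex_of_real (N f t)) \<in> borel_measurable borel"
      "(\<lambda>t. complex_of_real (N g t)) \<in> borel_measurable borel"
    using c unfolding N_def by (auto intro: borel_measurable_of_real)
  have s: "L2norm (\<lambda>t. complex_of_real (N f t)) = (L2norm f)\<^sup>2"
      "L2norm (\<lambda>t. complex_of_real (N g t)) = (L2norm g)\<^sup>2"
    using c(3,6) unfolding L2norm_def[of "\<lambda>t. complex_of_real (N _ t)"]
    by (simp_all add: real_sqrt_unique N_def)
  have "integrable lborel (\<lambda>t. (cmod (complex_of_real (N f t)))\<^sup>2)"
      "integrable lborel (\<lambda>t. (cmod (complex_of_real (N g t)))\<^sup>2)"
    using c by (simp_all add: N_def)
  from L2_Cauchy_Schwarz(1,2)[OF m this] show "integrable lborel (\<lambda>t. N f t * N g t)"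
    "(\<integral>t. N f t * N g t \<partial>lborel) \<le> (L2norm f)\<^sup>2 * (L2norm g)\<^sup>2"
    by (simp_all add: n s)
qed

text \<open>Here \<open>\<nu>\<close> stands for the size of the oscillation parameter, and all
  oscillation is hidden in \<open>kernel\<close>, the decay of the twice differenced amplitude. The
  factor \<open>2 * M\<^sup>2\<close> in the constant comes from small shifts (sup bound times the
  length \<open>2 * \<delta>\<close>), the factor \<open>sqrt (C * pi)\<close> from large ones; the
  outer root undoes the first Cauchy--Schwarz step.\<close>

lemma trilinear_form_bbs_bound:
  fixes A :: "real \<times> real \<Rightarrow> complex" and f g h :: "real \<Rightarrow> complex"
  assumes A: "bbs A" and f: "bbs f" and g: "bbs g" and h: "bbs h"
    and C: "C \<ge> 0" and \<nu>: "\<nu> > 0" and M: "\<And>p. cmod (A p) \<le> M"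
    and kernel: "\<And>t x s. t \<noteq> 0 \<Longrightarrow> cmod (\<integral>y. A (x,y) * cnj (A (x+t,y-t)) *
        cnj (A (x+s,y) * cnj (A (x+s+t,y-t))) \<partial>lborel) \<le> C / (1 + (\<nu> * \<bar>t\<bar> * s)\<^sup>2)"
  shows "cmod (\<integral>x. (\<integral>y. A (x,y) * f x * g y * h (x+y) \<partial>lborel) \<partial>lborel)
    \<le> sqrt (2 * M\<^sup>2 + sqrt (C * pi)) * \<nu> powr (-1/6) * L2norm f * L2norm g * L2norm h"
proof -
  obtain RA where A_meas: "A \<in> borel_measurable borel" and RA: "\<And>x. A x \<noteq> 0 \<Longrightarrow> norm x \<le> RA"
    using A by (metis bbsE)
  have [measurable]: "A \<in> borel_measurable (borel \<Otimes>\<^sub>M borel)"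
    using A_meas by (simp add: borel_prod)
  have M0: "M \<ge> 0" using M[of 0] norm_ge_zero order_trans by blast
  obtain Bf where [measurable]: "f \<in> borel_measurable borel" and Bf: "\<And>x. norm (f x) \<le> Bf"
    using f by (metis bbsE)
  obtain Bg where [measurable]: "g \<in> borel_measurable borel" and Bg: "\<And>x. norm (g x) \<le> Bg"
    using g by (metis bbsE)
  obtain Bh where [measurable]: "h \<in> borel_measurable borel" and Bh: "\<And>x. norm (h x) \<le> Bh"
    using h by (metis bbsE)
  have B0: "Bf \<ge> 0" "Bg \<ge> 0" "Bh \<ge> 0"
    using Bf[of 0] Bg[of 0] Bh[of 0] norm_ge_zero order_trans by blast+
  have RA': "\<bar>x\<bar> \<le> RA" "\<bar>y\<bar> \<le> RA" if "A (x, y) \<noteq> 0" for x y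
    using RA[of "(x,y)"] norm_snd_le[of y x] norm_fst_le[of x y] that by auto
  \<comment> \<open>The variables are now x and z = x + y, so that \<open>h\<close> depends on z
    only and Cauchy--Schwarz in z removes it.\<close>
  define q where "q = (\<lambda>p. A (fst p, snd p - fst p) * f (fst p) * g (snd p - fst p))"
  have q: "bbs q"
  proof (rule bbs_pairI[where M="M*Bf*Bg" and R=RA and R'="2*RA"])
    show "q \<in> borel_measurable (borel \<Otimes>\<^sub>M borel)" unfolding q_def by measurable
    show "norm (q (x,y)) \<le> M*Bf*Bg" for x y
      using M Bf Bg B0 M0 by (auto simp: q_def norm_mult intro!: mult_mono)
    show "q (x,y) \<noteq> 0 \<Longrightarrow> \<bar>x\<bar> \<le> RA \<and> \<bar>y\<bar> \<le> 2*RA" for x y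
      using RA'[of x "y-x"] by (auto simp: q_def)
  qed
  have qh: "bbs (\<lambda>p. q p * h (snd p))"
    by (rule bbs_mult_bounded[OF q, where M=Bh]) (auto simp: borel_prod[symmetric] Bh)
  define H where "H = (\<lambda>z. \<integral>x. q (x,z) \<partial>lborel)"
  have H: "bbs H" unfolding H_def using bbs_partial_integral[OF bbs_swap[OF q]] by simp
  have "(\<integral>x. (\<integral>y. A (x,y) * f x * g y * h (x+y) \<partial>lborel) \<partial>lborel)
      = (\<integral>x. (\<integral>z. q (x,z) * h z \<partial>lborel) \<partial>lborel)"
  proof (rule Bochner_Integration.integral_cong[OF refl])
    show "(\<integral>y. A (x,y) * f x * g y * h (x+y) \<partial>lborel) = (\<integral>z. q (x,z) * h z \<partial>lborel)" for x
      using integral_shift[of "\<lambda>z. q (x,z) * h z" x] by (simp add: q_def)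
  qed
  also have "\<dots> = (\<integral>z. (\<integral>x. q (x,z) * h z \<partial>lborel) \<partial>lborel)"
    using bbs_iterated[OF qh] by simp
  also have "\<dots> = (\<integral>z. H z * h z \<partial>lborel)" by (simp add: H_def)
  finally have 1: "cmod (\<integral>x. (\<integral>y. A (x,y) * f x * g y * h (x+y) \<partial>lborel) \<partial>lborel) \<le> L2norm H * L2norm h"
    using bbs_Cauchy_Schwarz(3)[OF H h] by simp

  define F where "F = (\<lambda>t x. f x * cnj (f (x+t)))"
  define G where "G = (\<lambda>t y. g y * cnj (g (y+t)))"
  define b where "b = (\<lambda>t p. A p * cnj (A (fst p + t, snd p - t)))"
  \<comment> \<open>Solves \<delta> = (\<nu> \<delta>)^(-1/2), which equalises the two
    contributions.\<close>
  define \<delta> where "\<delta> = \<nu> powr (-1/3)"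
  have \<delta>: "\<delta> > 0" using \<nu> by (simp add: \<delta>_def)
  have F: "bbs (F t)" and G: "bbs (G t)" for t
    unfolding F_def G_def by (intro bbs_real_correlation f g)+
  have b: "bbs (b t)" for t
    unfolding b_def by (rule bbs_mult_bounded[OF A, where M=M]) (auto simp: borel_prod[symmetric] M)
  have bM: "cmod (b t p) \<le> M\<^sup>2" for t p
    unfolding b_def norm_mult power2_eq_square using M M0 by (intro mult_mono) (simp_all only: complex_mod_cnj norm_ge_zero)
  define J where "J = (\<lambda>t. \<integral>x. (\<integral>z. q (x,z) * cnj (q (x+t,z)) \<partial>lborel) \<partial>lborel)"
  \<comment> \<open>At fixed z, moving x to x + t moves y = z - x to y - t; hence the opposite
    shifts in \<open>F\<close> and \<open>G\<close>.\<close>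
  have J: "J t = (\<integral>x. (\<integral>y. b t (x,y) * F t x * G (-t) y \<partial>lborel) \<partial>lborel)" for t
    unfolding J_def
  proof (rule Bochner_Integration.integral_cong[OF refl])
    fix x
    have "q (x, x + y) * cnj (q (x + t, x + y)) = b t (x, y) * F t x * G (- t) y" for y
      by (simp add: q_def b_def F_def G_def algebra_simps)
    then show "(\<integral>z. q (x,z) * cnj (q (x+t,z)) \<partial>lborel) = (\<integral>y. b t (x,y) * F t x * G (-t) y \<partial>lborel)"
      using integral_shift[of "\<lambda>z. q (x,z) * cnj (q (x+t,z))" x] by simp
  qed
  have small: "cmod (J t) \<le> M\<^sup>2 * (L2norm f)\<^sup>2 * (L2norm g)\<^sup>2" for t
  proof -
    have iF: "integrable lborel (\<lambda>x. cmod (F t x))" "(\<integral>x. cmod (F t x) \<partial>lborel) \<le> (L2norm f)\<^sup>2"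
      using bbs_correlation_L1[OF f] by (simp_all add: F_def norm_mult)
    have iG: "integrable lborel (\<lambda>x. cmod (G (-t) x))" "(\<integral>x. cmod (G (-t) x) \<partial>lborel) \<le> (L2norm g)\<^sup>2"
      using bbs_correlation_L1[OF g, of "-t"] by (simp_all add: G_def norm_mult)
    have "cmod (J t) \<le> (\<integral>x. M\<^sup>2 * (L2norm g)\<^sup>2 * cmod (F t x) \<partial>lborel)"
      unfolding J
    proof (rule norm_integral_le)
      show "integrable lborel (\<lambda>x. M\<^sup>2 * (L2norm g)\<^sup>2 * cmod (F t x))" using iF by simp
      fix x
      have "cmod (\<integral>y. b t (x,y) * F t x * G (-t) y \<partial>lborel) \<le> (\<integral>y. M\<^sup>2 * cmod (F t x) * cmod (G (-t) y) \<partial>lborel)"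
        by (rule norm_integral_le) (use iG bM in \<open>auto simp: norm_mult intro!: mult_right_mono\<close>)
      also have "\<dots> = M\<^sup>2 * cmod (F t x) * (\<integral>y. cmod (G (-t) y) \<partial>lborel)" by simp
      also have "\<dots> \<le> M\<^sup>2 * cmod (F t x) * (L2norm g)\<^sup>2"
        by (rule mult_left_mono[OF iG(2)]) simp
      finally show "cmod (\<integral>y. b t (x,y) * F t x * G (-t) y \<partial>lborel) \<le> M\<^sup>2 * (L2norm g)\<^sup>2 * cmod (F t x)"
        by (simp add: mult_ac)
    qed
    also have "\<dots> = M\<^sup>2 * (L2norm g)\<^sup>2 * (\<integral>x. cmod (F t x) \<partial>lborel)" by simp
    also have "\<dots> \<le> M\<^sup>2 * (L2norm g)\<^sup>2 * (L2norm f)\<^sup>2"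
      by (rule mult_left_mono[OF iF(2)]) simp
    finally show ?thesis by (simp add: mult_ac)
  qed
  have large: "cmod (J t) \<le> sqrt (C * pi / (\<nu> * \<bar>t\<bar>)) * L2norm (F t) * L2norm (G (-t))" if "t \<noteq> 0" for t
    unfolding J
  proof (rule oscillatory_form_L2_bound[OF b F G C])
    show "\<nu> * \<bar>t\<bar> > 0" using \<nu> that by simp
    show "cmod (\<integral>y. b t (x,y) * cnj (b t (x+s,y)) \<partial>lborel) \<le> C / (1 + (\<nu> * \<bar>t\<bar> * s)\<^sup>2)" for x s
      using kernel[OF that, of x s] by (simp add: b_def)
  qed
  \<comment> \<open>Correlating with shift -t and translating by t gives, up to conjugation, the
    correlation with shift t.\<close>
  have Gsym: "L2norm (G (-t)) = L2norm (G t)" for t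
  proof -
    have "L2norm (G (-t)) = L2norm (\<lambda>y. G (-t) (y + t))" by (simp only: L2norm_shift)
    also have "\<dots> = L2norm (G t)" by (simp add: G_def L2norm_def norm_mult mult.commute)
    finally show ?thesis .
  qed
  define \<kappa> where "\<kappa> = sqrt (C * pi) * \<nu> powr (-1/3)"
  have \<kappa>: "sqrt (C * pi / (\<nu> * \<delta>)) = \<kappa>"
  proof -
    have "\<nu> * \<delta> = \<nu> powr 1 * \<nu> powr (-1/3)" using \<nu> by (simp add: \<delta>_def)
    also have "\<dots> = \<nu> powr (1/3) * \<nu> powr (1/3)" unfolding powr_add[symmetric] by simp
    finally have "sqrt (\<nu> * \<delta>) = \<nu> powr (1/3)" by simp
    moreover have "\<nu> powr (-1/3) = 1 / \<nu> powr (1/3)" using powr_minus_divide[of \<nu> "1/3"] by simp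
    ultimately show ?thesis by (simp add: \<kappa>_def real_sqrt_divide)
  qed
  \<comment> \<open>Keeping the second summand for every t gives a single integrable majorant; for
    |t| > \<delta> the factor \<open>sqrt (C * pi / (\<nu> * \<bar>t\<bar>))\<close> is at most its
    value \<open>\<kappa>\<close> at \<delta>. The point t = 0, which \<open>kernel\<close>
    excludes, falls under the trivial bound.\<close>
  have J_le: "cmod (J t) \<le> M\<^sup>2 * (L2norm f)\<^sup>2 * (L2norm g)\<^sup>2 * indicator {-\<delta>..\<delta>} t
      + \<kappa> * (L2norm (F t) * L2norm (G t))" for t
  proof (cases "\<bar>t\<bar> \<le> \<delta>")
    case True
    have "\<kappa> * (L2norm (F t) * L2norm (G t)) \<ge> 0" using C by (simp add: \<kappa>_def)
    then show ?thesis using small[of t] True by (auto simp: indicator_def)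
  next
    case False
    have "sqrt (C * pi / (\<nu> * \<bar>t\<bar>)) \<le> \<kappa>" unfolding \<kappa>[symmetric]
      using False \<delta> C \<nu> by (intro real_sqrt_le_mono divide_left_mono mult_left_mono) auto
    then have "sqrt (C * pi / (\<nu> * \<bar>t\<bar>)) * (L2norm (F t) * L2norm (G t)) \<le> \<kappa> * (L2norm (F t) * L2norm (G t))"
      by (rule mult_right_mono) simp
    then show ?thesis using large[of t] False \<delta> by (auto simp: indicator_def Gsym mult_ac)
  qed
  have ind: "integrable lborel (indicator {-\<delta>..\<delta>} :: real \<Rightarrow> real)"
    by (rule integrable_real_indicator) (use \<delta> in auto)
  have "(L2norm H)\<^sup>2 = cmod (complex_of_real (\<integral>y. (cmod (H y))\<^sup>2 \<partial>lborel))"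
    by (simp add: L2norm_square)
  also have "\<dots> = cmod (\<integral>t. J t \<partial>lborel)"
    using integral_square_correlation[OF q] by (simp add: H_def J_def)
  also have "\<dots> \<le> (\<integral>t. M\<^sup>2 * (L2norm f)\<^sup>2 * (L2norm g)\<^sup>2 * indicator {-\<delta>..\<delta>} t
      + \<kappa> * (L2norm (F t) * L2norm (G t)) \<partial>lborel)"
    using integral_L2norm_correlation_le[OF f g] ind
    by (intro norm_integral_le J_le Bochner_Integration.integrable_add integrable_mult_right)
      (auto simp: F_def G_def)
  also have "\<dots> = M\<^sup>2 * (L2norm f)\<^sup>2 * (L2norm g)\<^sup>2 * (2 * \<delta>) + \<kappa> * (\<integral>t. L2norm (F t) * L2norm (G t) \<partial>lborel)"
    using integral_L2norm_correlation_le(1)[OF f g] \<delta> ind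
    by (subst Bochner_Integration.integral_add) (auto simp: F_def G_def)
  also have "\<dots> \<le> M\<^sup>2 * (L2norm f)\<^sup>2 * (L2norm g)\<^sup>2 * (2 * \<delta>) + \<kappa> * ((L2norm f)\<^sup>2 * (L2norm g)\<^sup>2)"
    using integral_L2norm_correlation_le(2)[OF f g] C
    by (intro add_left_mono mult_left_mono) (auto simp: F_def G_def \<kappa>_def)
  also have "\<dots> = (2 * M\<^sup>2 + sqrt (C * pi)) * (\<nu> powr (-1/6))\<^sup>2 * (L2norm f * L2norm g)\<^sup>2"
  proof -
    have alg: "m * a * b * (2 * d) + k * d * (a * b) = (2 * m + k) * d * (a * b)" for m a b d k :: real
      by (simp add: algebra_simps)
    have sq: "(\<nu> powr (-1/6))\<^sup>2 = \<nu> powr (-1/3)"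
      unfolding power2_eq_square powr_add[symmetric] by simp
    show ?thesis unfolding \<delta>_def \<kappa>_def power_mult_distrib[of "L2norm f"] sq by (rule alg)
  qed
  also have "\<dots> = (sqrt (2 * M\<^sup>2 + sqrt (C * pi)) * \<nu> powr (-1/6) * (L2norm f * L2norm g))\<^sup>2"
    using C by (simp add: power_mult_distrib)
  finally have "L2norm H \<le> sqrt (2 * M\<^sup>2 + sqrt (C * pi)) * \<nu> powr (-1/6) * (L2norm f * L2norm g)"
    by (rule power2_le_imp_le) (use C in simp)
  then have "L2norm H * L2norm h \<le> sqrt (2 * M\<^sup>2 + sqrt (C * pi)) * \<nu> powr (-1/6) * (L2norm f * L2norm g) * L2norm h"
    by (rule mult_right_mono) simp
  with 1 show ?thesis by (simp add: mult_ac)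
qed

section \<open>Oscillatory integrals along a line\<close>

text \<open>The lines are parametrised by multiples \<open>c *\<^sub>R v\<close> of the unit
  vectors, whereas the derivatives of \<open>S\<close> are taken along the unit vectors themselves;
  each differentiation therefore costs a factor \<open>c\<close>.\<close>

lemma has_vector_derivative_along_line:
  fixes f :: "R2 \<Rightarrow> 'b::real_normed_vector"
  assumes "f differentiable at (Q + y *\<^sub>R (c *\<^sub>R v))"
  shows "((\<lambda>y. f (Q + y *\<^sub>R (c *\<^sub>R v))) has_vector_derivative c *\<^sub>R dirD v f (Q + y *\<^sub>R (c *\<^sub>R v))) (at y)"
proof -
  let ?z = "Q + y *\<^sub>R (c *\<^sub>R v)" and ?l = "\<lambda>y. Q + y *\<^sub>R (c *\<^sub>R v)"
  have f: "(f has_derivative frechet_derivative f (at ?z)) (at ?z)"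
    using assms frechet_derivative_works by blast
  have l: "(?l has_derivative (\<lambda>h. h *\<^sub>R (c *\<^sub>R v))) (at y)"
    by (auto intro!: derivative_eq_intros)
  have "((\<lambda>y. f (?l y)) has_derivative (\<lambda>h. frechet_derivative f (at ?z) (h *\<^sub>R (c *\<^sub>R v)))) (at y)"
    by (rule has_derivative_compose[OF l f])
  moreover have "linear (frechet_derivative f (at ?z))"
    by (rule linear_frechet_derivative[OF assms])
  ultimately show ?thesis
    by (simp add: has_vector_derivative_def dirD_def linear_scale)
qed

text \<open>Two applications of the mean value theorem: along \<open>v\<close> to the difference of
  \<open>g\<close> on two opposite sides of the parallelogram, then along \<open>u\<close> to
  \<open>dirD v g\<close>. Convexity keeps all intermediate points in \<open>K\<close> once the four
  vertices are there, which is why the lower bound is assumed on a convex hull.\<close>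

lemma second_difference_mvt:
  fixes g :: "R2 \<Rightarrow> real"
  assumes K: "convex K"
    and g: "\<And>z. z \<in> K \<Longrightarrow> g differentiable at z" "\<And>z. z \<in> K \<Longrightarrow> dirD v g differentiable at z"
    and P: "P \<in> K" "P + \<sigma> *\<^sub>R v \<in> K" "P + \<tau> *\<^sub>R u \<in> K" "P + \<tau> *\<^sub>R u + \<sigma> *\<^sub>R v \<in> K"
  shows "\<exists>\<xi>\<in>K. g P - g (P + \<tau> *\<^sub>R u) - g (P + \<sigma> *\<^sub>R v) + g (P + \<tau> *\<^sub>R u + \<sigma> *\<^sub>R v)
    = \<sigma> * \<tau> * dirD u (dirD v g) \<xi>"
proof -
  have seg: "X + y *\<^sub>R w \<in> K" if "X \<in> K" "X + w \<in> K" "0 \<le> y" "y \<le> 1" for X w y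
  proof -
    have "(1 - y) *\<^sub>R X + y *\<^sub>R (X + w) \<in> K" using that K by (intro convexD) auto
    then show ?thesis by (simp add: algebra_simps)
  qed
  have d: "((\<lambda>y. g (X + y *\<^sub>R (\<sigma> *\<^sub>R v))) has_real_derivative \<sigma> * dirD v g (X + y *\<^sub>R (\<sigma> *\<^sub>R v))) (at y)"
    if "X \<in> K" "X + \<sigma> *\<^sub>R v \<in> K" "0 \<le> y" "y \<le> 1" for X y
    using has_vector_derivative_along_line[OF g(1)[OF seg[OF that]]]
    by (simp add: has_real_derivative_iff_has_vector_derivative)
  define h where "h = (\<lambda>y. g (P + \<tau> *\<^sub>R u + y *\<^sub>R (\<sigma> *\<^sub>R v)) - g (P + y *\<^sub>R (\<sigma> *\<^sub>R v)))"
  have "\<exists>y. 0 < y \<and> y < 1 \<and> h 1 - h 0 = (1 - 0) *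
      (\<sigma> * dirD v g (P + \<tau> *\<^sub>R u + y *\<^sub>R (\<sigma> *\<^sub>R v)) - \<sigma> * dirD v g (P + y *\<^sub>R (\<sigma> *\<^sub>R v)))"
    unfolding h_def by (rule MVT2, simp) (intro DERIV_diff d P; simp)
  then obtain y where y: "0 < y" "y < 1" and h: "h 1 - h 0 =
      \<sigma> * (dirD v g (P + \<tau> *\<^sub>R u + y *\<^sub>R (\<sigma> *\<^sub>R v)) - dirD v g (P + y *\<^sub>R (\<sigma> *\<^sub>R v)))"
    by (auto simp: right_diff_distrib)
  \<comment> \<open>\<open>X\<close> and \<open>X + \<tau> *\<^sub>R u\<close> are corresponding
    points of the two sides parallel to \<open>v\<close>.\<close>
  define X where "X = P + y *\<^sub>R (\<sigma> *\<^sub>R v)"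
  have X: "X \<in> K" "X + \<tau> *\<^sub>R u \<in> K"
    using seg[OF P(1,2), of y] seg[OF P(3,4), of y] y by (auto simp: X_def algebra_simps)
  have "\<exists>x. 0 < x \<and> x < 1 \<and> dirD v g (X + 1 *\<^sub>R (\<tau> *\<^sub>R u)) - dirD v g (X + 0 *\<^sub>R (\<tau> *\<^sub>R u)) = (1 - 0) *
      (\<tau> * dirD u (dirD v g) (X + x *\<^sub>R (\<tau> *\<^sub>R u)))"
  proof (rule MVT2)
    fix x :: real assume "0 \<le> x" "x \<le> 1"
    then show "((\<lambda>x. dirD v g (X + x *\<^sub>R (\<tau> *\<^sub>R u))) has_real_derivative
        \<tau> * dirD u (dirD v g) (X + x *\<^sub>R (\<tau> *\<^sub>R u))) (at x)"
      using has_vector_derivative_along_line[OF g(2)[OF seg[OF X]]]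
      by (simp add: has_real_derivative_iff_has_vector_derivative)
  qed simp
  then obtain x where x: "0 < x" "x < 1" and "dirD v g (X + \<tau> *\<^sub>R u) - dirD v g X =
      \<tau> * dirD u (dirD v g) (X + x *\<^sub>R (\<tau> *\<^sub>R u))" by auto
  with h have "h 1 - h 0 = \<sigma> * (\<tau> * dirD u (dirD v g) (X + x *\<^sub>R (\<tau> *\<^sub>R u)))"
    by (simp add: X_def algebra_simps)
  moreover have "X + x *\<^sub>R (\<tau> *\<^sub>R u) \<in> K" using seg[OF X] x by simp
  ultimately show ?thesis by (intro bexI[of _ "X + x *\<^sub>R (\<tau> *\<^sub>R u)"]) (auto simp: h_def)
qed

text \<open>With T B = (B / \<psi>')', integrating by parts twice turns the integral of e^(i \<psi>)
  B into minus that of e^(i \<psi>) T (T B). Measuring the higher derivatives of the phase in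
  multiples of \<open>\<mu>\<close> makes every term of T (T B) of size
  \<open>1 / \<mu>\<^sup>2\<close>, whatever the size of \<open>\<mu>\<close>.\<close>

lemma oscillatory_integral_by_parts:
  fixes \<psi> \<psi>1 \<psi>2 \<psi>3 :: "real \<Rightarrow> real" and B B1 B2 :: "real \<Rightarrow> complex"
  assumes cd: "c \<le> d" and \<mu>: "\<mu> > 0" and L: "L \<ge> 0"
    and d\<psi>: "\<And>y. y \<in> {c..d} \<Longrightarrow> (\<psi> has_vector_derivative \<psi>1 y) (at y)"
      "\<And>y. y \<in> {c..d} \<Longrightarrow> (\<psi>1 has_vector_derivative \<psi>2 y) (at y)"
      "\<And>y. y \<in> {c..d} \<Longrightarrow> (\<psi>2 has_vector_derivative \<psi>3 y) (at y)"
    and \<psi>: "\<And>y. y \<in> {c..d} \<Longrightarrow> \<bar>\<psi>1 y\<bar> \<ge> \<mu>" "\<And>y. y \<in> {c..d} \<Longrightarrow> \<bar>\<psi>2 y\<bar> \<le> L * \<mu>"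
      "\<And>y. y \<in> {c..d} \<Longrightarrow> \<bar>\<psi>3 y\<bar> \<le> L * \<mu>"
    and dB: "\<And>y. y \<in> {c..d} \<Longrightarrow> (B has_vector_derivative B1 y) (at y)"
      "\<And>y. y \<in> {c..d} \<Longrightarrow> (B1 has_vector_derivative B2 y) (at y)"
    and B: "\<And>y. y \<in> {c..d} \<Longrightarrow> cmod (B y) \<le> M" "\<And>y. y \<in> {c..d} \<Longrightarrow> cmod (B1 y) \<le> M"
      "\<And>y. y \<in> {c..d} \<Longrightarrow> cmod (B2 y) \<le> M"
    and ends: "B c = 0" "B d = 0" "B1 c = 0" "B1 d = 0"
  shows "cmod (integral {c..d} (\<lambda>y. exp (\<i> * of_real (\<psi> y)) * B y)) \<le> M * (1 + 4 * L + 3 * L\<^sup>2) / \<mu>\<^sup>2 * (d - c)"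
proof -
  define e where "e = (\<lambda>y. exp (\<i> * complex_of_real (\<psi> y)))"
  define q where "q = (\<lambda>y. complex_of_real (1 / \<psi>1 y))"
  \<comment> \<open>\<open>R\<close> is T (T B) written out with q = 1 / \<psi>'. Its coefficients
    1, 3, 1, 3 produce the polynomial 1 + 4 L + 3 L^2.\<close>
  define R where "R = (\<lambda>y. B2 y * q y ^ 2 - 3 * B1 y * \<psi>2 y * q y ^ 3 - B y * \<psi>3 y * q y ^ 3
      + 3 * B y * \<psi>2 y ^ 2 * q y ^ 4)"
  \<comment> \<open>\<open>W\<close> collects the boundary terms of both integrations by parts: -i e
    B q from the first, e (T B) q from the second.\<close>
  define W where "W = (\<lambda>y. e y * (- \<i> * B y * q y + B1 y * q y ^ 2 - B y * \<psi>2 y * q y ^ 3))"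
  have nz: "\<psi>1 y \<noteq> 0" if "y \<in> {c..d}" for y using \<psi>(1)[OF that] \<mu> by auto
  have of_real: "((\<lambda>y. complex_of_real (p y)) has_vector_derivative of_real p') (at y)"
    if "(p has_vector_derivative p') (at y)" for p p' y
    using bounded_linear.has_vector_derivative[OF bounded_linear_of_real that] .
  have de: "(e has_vector_derivative \<i> * \<psi>1 y * e y) (at y)" if "y \<in> {c..d}" for y
  proof -
    have "((\<lambda>y. \<i> * complex_of_real (\<psi> y)) has_vector_derivative \<i> * of_real (\<psi>1 y)) (at y)"
      using has_vector_derivative_mult_right[OF of_real[OF d\<psi>(1)[OF that]]] .
    from field_vector_diff_chain_at[OF this, of exp "exp (\<i> * complex_of_real (\<psi> y))"]
    show ?thesis by (simp add: e_def o_def DERIV_exp)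
  qed
  have dq: "(q has_vector_derivative - \<psi>2 y * q y ^ 2) (at y)" if "y \<in> {c..d}" for y
  proof -
    have "((\<lambda>y. 1 / \<psi>1 y) has_real_derivative - \<psi>2 y * (1 / \<psi>1 y) ^ 2) (at y)"
      using d\<psi>(2)[OF that] nz[OF that]
      by (auto intro!: derivative_eq_intros simp: has_real_derivative_iff_has_vector_derivative[symmetric] power2_eq_square)
    then have "((\<lambda>y. 1 / \<psi>1 y) has_vector_derivative - \<psi>2 y * (1 / \<psi>1 y) ^ 2) (at y)"
      by (simp add: has_real_derivative_iff_has_vector_derivative)
    from of_real[OF this] show ?thesis by (simp add: q_def)
  qed
  have dW: "(W has_vector_derivative e y * B y + e y * R y) (at y)" if y: "y \<in> {c..d}" for y
  proof -
    note m = has_vector_derivative_mult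
    note dq2 = m[OF dq[OF y] dq[OF y]]
    note dq3 = m[OF dq[OF y] dq2]
    have "(W has_vector_derivative
       (e y * ((- \<i> * (B y * (- \<psi>2 y * q y ^ 2) + B1 y * q y)
          + (B1 y * (q y * (- \<psi>2 y * q y ^ 2) + (- \<psi>2 y * q y ^ 2) * q y) + B2 y * (q y * q y)))
          - (B y * (of_real (\<psi>2 y) * (q y * (q y * (- \<psi>2 y * q y ^ 2) + (- \<psi>2 y * q y ^ 2) * q y)
               + (- \<psi>2 y * q y ^ 2) * (q y * q y)) + of_real (\<psi>3 y) * (q y * (q y * q y)))
             + B1 y * (of_real (\<psi>2 y) * (q y * (q y * q y)))))
        + (\<i> * \<psi>1 y * e y) * ((- \<i> * (B y * q y) + B1 y * (q y * q y)) - B y * (of_real (\<psi>2 y) * (q y * (q y * q y)))))) (at y)"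
      (is "(_ has_vector_derivative ?W') _")
    proof -
      have "W = (\<lambda>y. e y * ((- \<i> * (B y * q y) + B1 y * (q y * q y)) - B y * (of_real (\<psi>2 y) * (q y * (q y * q y)))))"
        by (simp add: W_def fun_eq_iff power2_eq_square power3_eq_cube mult_ac)
      then show ?thesis
        by (simp only:) (intro m de[OF y] has_vector_derivative_diff has_vector_derivative_add
          has_vector_derivative_mult_right dq2 dq3 dB[OF y] dq[OF y] of_real d\<psi>(3)[OF y])
    qed
    moreover have "?W' = e y * B y + e y * R y"
    proof -
      have 1: "\<psi>1 y * q y = 1" using nz[OF y] by (simp add: q_def)
      \<comment> \<open>Differentiating \<open>e\<close> brings out a factor \<psi>', which cancels
        one \<open>q\<close>. This leaves \<open>e y * B y\<close> and lower terms that cancel the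
        derivative of the first boundary term.\<close>
      have "?W' = e y * (\<psi>1 y * q y) * (B y + \<i> * B1 y * q y - \<i> * B y * \<psi>2 y * q y ^ 2)
          + e y * (R y - \<i> * B1 y * q y + \<i> * B y * \<psi>2 y * q y ^ 2)"
        unfolding R_def by (simp add: algebra_simps power2_eq_square power3_eq_cube power4_eq_xxxx)
      also have "\<dots> = e y * B y + e y * R y" unfolding 1 by (simp add: algebra_simps)
      finally show ?thesis .
    qed
    ultimately show ?thesis by simp
  qed
  have ftc: "((\<lambda>y. e y * B y + e y * R y) has_integral W d - W c) {c..d}"
    by (rule fundamental_theorem_of_calculus[OF cd]) (rule has_vector_derivative_at_within[OF dW])
  have "continuous_on {c..d} (\<lambda>y. e y * B y)"
    using de dB(1) has_vector_derivative_continuous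
    by (intro continuous_on_mult continuous_at_imp_continuous_on) blast+
  then have eB: "((\<lambda>y. e y * B y) has_integral integral {c..d} (\<lambda>y. e y * B y)) {c..d}"
    using integrable_continuous_interval by blast
  \<comment> \<open>\<open>B2\<close> and \<open>\<psi>3\<close> are not assumed continuous, so
    integrability of \<open>e y * R y\<close> is read off as a derivative minus a continuous
    function, in the gauge sense. Both values of \<open>W\<close> vanish by
    \<open>ends\<close>.\<close>
  have eR: "((\<lambda>y. e y * R y) has_integral - integral {c..d} (\<lambda>y. e y * B y)) {c..d}"
    using has_integral_diff[OF ftc eB] by (simp add: W_def ends)
  have R_le: "cmod (e y * R y) \<le> M * (1 + 4 * L + 3 * L\<^sup>2) / \<mu>\<^sup>2" if y: "y \<in> {c..d}" for y
  proof -
    have M0: "M \<ge> 0" using B(1)[OF y] norm_ge_zero order_trans by blast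
    have e1: "cmod (e y) = 1" by (simp add: e_def)
    have q: "cmod (q y) \<le> 1 / \<mu>"
      using \<psi>(1)[OF y] \<mu> by (auto simp: q_def norm_divide intro!: divide_left_mono)
    have qn: "cmod (q y ^ n) \<le> (1 / \<mu>) ^ n" for n
      unfolding norm_power by (rule power_mono[OF q]) simp
    have \<psi>2: "cmod (\<psi>2 y) \<le> L * \<mu>" "cmod (\<psi>3 y) \<le> L * \<mu>" using \<psi>(2,3)[OF y] by auto
    have 1: "cmod (B2 y * q y ^ 2) \<le> M * (1/\<mu>)^2"
      unfolding norm_mult by (intro mult_mono B(3)[OF y] qn) (use M0 in auto)
    have 2: "cmod (3 * B1 y * \<psi>2 y * q y ^ 3) \<le> 3 * M * (L * \<mu>) * (1/\<mu>)^3"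
      unfolding norm_mult by (intro mult_mono B(2)[OF y] qn \<psi>2) (use M0 L \<mu> in auto)
    have 3: "cmod (B y * \<psi>3 y * q y ^ 3) \<le> M * (L * \<mu>) * (1/\<mu>)^3"
      unfolding norm_mult by (intro mult_mono B(1)[OF y] qn \<psi>2) (use M0 L \<mu> in auto)
    have 4: "cmod (3 * B y * \<psi>2 y ^ 2 * q y ^ 4) \<le> 3 * M * (L * \<mu>)^2 * (1/\<mu>)^4"
    proof -
      have "cmod (complex_of_real (\<psi>2 y) ^ 2) \<le> (L * \<mu>)^2" unfolding norm_power by (rule power_mono[OF \<psi>2(1)]) simp
      then show ?thesis
        unfolding norm_mult by (intro mult_mono B(1)[OF y] qn) (use M0 L \<mu> in auto)
    qed
    have "cmod (R y) \<le> M * (1/\<mu>)^2 + 3 * M * (L * \<mu>) * (1/\<mu>)^3 + M * (L * \<mu>) * (1/\<mu>)^3 + 3 * M * (L * \<mu>)^2 * (1/\<mu>)^4"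
      unfolding R_def using norm_triangle_ineq4 norm_triangle_ineq 1 2 3 4
      by (intro norm_triangle_le norm_triangle_le_diff add_mono) auto
    also have "\<dots> = M * (1 + 4 * L + 3 * L\<^sup>2) / \<mu>\<^sup>2"
      using \<mu> by (simp add: field_simps power2_eq_square power3_eq_cube power4_eq_xxxx)
    finally show ?thesis by (simp add: norm_mult e1)
  qed
  have nn: "0 \<le> M * (1 + 4 * L + 3 * L\<^sup>2) / \<mu>\<^sup>2"
  proof -
    have "c \<in> {c..d}" using cd by simp
    from order_trans[OF norm_ge_zero B(1)[OF this]] have "M \<ge> 0" .
    then show ?thesis using L by simp
  qed
  have "cmod (- integral {c..d} (\<lambda>y. e y * B y)) \<le> M * (1 + 4 * L + 3 * L\<^sup>2) / \<mu>\<^sup>2 * measure lborel {c..d}"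
    by (rule has_integral_bound_real[where S="{}", OF nn _ eR]) (use R_le in auto)
  then show ?thesis using cd by (simp add: e_def)
qed

text \<open>Hiding the derivatives behind the quantifier and using one constant for all three bounds
  lets the fourfold product of shifted cutoffs be treated by closure rules alone.\<close>

definition C2_bounded :: "real \<Rightarrow> (real \<Rightarrow> complex) \<Rightarrow> bool" where
  "C2_bounded M f \<longleftrightarrow> (\<exists>f1 f2. \<forall>y. (f has_vector_derivative f1 y) (at y) \<and>
     (f1 has_vector_derivative f2 y) (at y) \<and> cmod (f y) \<le> M \<and> cmod (f1 y) \<le> M \<and> cmod (f2 y) \<le> M)"

lemma C2_boundedE:
  assumes "C2_bounded M f"
  obtains f1 f2 where "\<And>y. (f has_vector_derivative f1 y) (at y)"
    "\<And>y. (f1 has_vector_derivative f2 y) (at y)"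
    "\<And>y. cmod (f y) \<le> M" "\<And>y. cmod (f1 y) \<le> M" "\<And>y. cmod (f2 y) \<le> M"
  using assms unfolding C2_bounded_def by blast

text \<open>The factor 4 = 1 + 2 + 1 counts the Leibniz terms of the second derivative.\<close>

lemma C2_bounded_mult:
  assumes "C2_bounded M f" "C2_bounded N g"
  shows "C2_bounded (4 * M * N) (\<lambda>y. f y * g y)"
proof -
  obtain f1 f2 where f: "\<And>y. (f has_vector_derivative f1 y) (at y)"
    "\<And>y. (f1 has_vector_derivative f2 y) (at y)"
    "\<And>y. cmod (f y) \<le> M" "\<And>y. cmod (f1 y) \<le> M" "\<And>y. cmod (f2 y) \<le> M"
    using C2_boundedE[OF assms(1)] by metis
  obtain g1 g2 where g: "\<And>y. (g has_vector_derivative g1 y) (at y)"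
    "\<And>y. (g1 has_vector_derivative g2 y) (at y)"
    "\<And>y. cmod (g y) \<le> N" "\<And>y. cmod (g1 y) \<le> N" "\<And>y. cmod (g2 y) \<le> N"
    using C2_boundedE[OF assms(2)] by metis
  have M: "M \<ge> 0" using f(3)[of 0] norm_ge_zero order_trans by blast
  have N: "N \<ge> 0" using g(3)[of 0] norm_ge_zero order_trans by blast
  have p: "cmod (u * v) \<le> M * N" if "cmod u \<le> M" "cmod v \<le> N" for u v
    unfolding norm_mult using that M by (intro mult_mono) auto
  have MN: "0 \<le> M * N" using M N by simp
  show ?thesis unfolding C2_bounded_def
  proof (intro exI allI conjI)
    fix y
    show "((\<lambda>y. f y * g y) has_vector_derivative f y * g1 y + f1 y * g y) (at y)"
      by (intro has_vector_derivative_mult f g)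
    show "((\<lambda>y. f y * g1 y + f1 y * g y) has_vector_derivative
        (f y * g2 y + f1 y * g1 y) + (f1 y * g1 y + f2 y * g y)) (at y)"
      by (intro has_vector_derivative_add has_vector_derivative_mult f g)
    have "cmod (f y * g y) \<le> M * N" by (intro p f g)
    then show "cmod (f y * g y) \<le> 4 * M * N" using MN by linarith
    have "cmod (f y * g1 y + f1 y * g y) \<le> M * N + M * N"
      by (intro norm_triangle_mono p f g)
    then show "cmod (f y * g1 y + f1 y * g y) \<le> 4 * M * N" using MN by linarith
    have "cmod ((f y * g2 y + f1 y * g1 y) + (f1 y * g1 y + f2 y * g y)) \<le> (M * N + M * N) + (M * N + M * N)"
      by (intro norm_triangle_mono p f g)
    then show "cmod ((f y * g2 y + f1 y * g1 y) + (f1 y * g1 y + f2 y * g y)) \<le> 4 * M * N" by linarith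
  qed
qed

lemma C2_bounded_cnj:
  assumes "C2_bounded M f" shows "C2_bounded M (\<lambda>y. cnj (f y))"
proof -
  obtain f1 f2 where f: "\<And>y. (f has_vector_derivative f1 y) (at y)"
    "\<And>y. (f1 has_vector_derivative f2 y) (at y)"
    "\<And>y. cmod (f y) \<le> M" "\<And>y. cmod (f1 y) \<le> M" "\<And>y. cmod (f2 y) \<le> M"
    using C2_boundedE[OF assms] by metis
  show ?thesis unfolding C2_bounded_def
    by (rule exI[of _ "\<lambda>y. cnj (f1 y)"], rule exI[of _ "\<lambda>y. cnj (f2 y)"])
      (use f bounded_linear.has_vector_derivative[OF bounded_linear_cnj] in auto)
qed

text \<open>Supplies the vanishing boundary data for the integration by parts: the amplitude is zero
  on the open complement of an interval, hence it and its derivative are zero at the endpoints by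
  continuity.\<close>

lemma derivative_zero_on_closure:
  fixes f f' f'' :: "real \<Rightarrow> complex"
  assumes f: "\<And>y. (f has_vector_derivative f' y) (at y)" "\<And>y. (f' has_vector_derivative f'' y) (at y)"
    and S: "open S" "\<And>y. y \<in> S \<Longrightarrow> f y = 0" and c: "c \<in> closure S"
  shows "f c = 0" "f' c = 0"
proof -
  have cont: "continuous_on (closure S) f" "continuous_on (closure S) f'"
    using f has_vector_derivative_continuous by (blast intro: continuous_at_imp_continuous_on)+
  show "f c = 0" using continuous_constant_on_closure[OF cont(1) S(2) c] .
  have "f' y = 0" if "y \<in> S" for y
  proof -
    have "(f has_vector_derivative 0) (at y)"
      using has_vector_derivative_transform_within_open[OF has_vector_derivative_const S(1) that, of 0 f] S(2)
      by simp
    then show ?thesis using f(1)[of y] vector_derivative_unique_at by blast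
  qed
  then show "f' c = 0" using continuous_constant_on_closure[OF cont(2) _ c] by blast
qed

text \<open>Sum of the trivial bound \<open>2 * r * M\<close> and the twice integrated bound
  multiplied by \<open>\<mu>\<^sup>2\<close>. The factor \<open>1 + \<mu>\<^sup>2\<close> gives
  decay that is integrable in the shift without a singularity at \<open>\<mu> = 0\<close>.\<close>

lemma oscillatory_integral_decay:
  fixes \<psi> \<psi>1 \<psi>2 \<psi>3 :: "real \<Rightarrow> real" and B :: "real \<Rightarrow> complex"
  assumes I: "convex I" "compact I" "I \<subseteq> {-r..r}" and r: "r \<ge> 0" and \<mu>: "\<mu> \<ge> 0" and L: "L \<ge> 0"
    and d\<psi>: "\<And>y. y \<in> I \<Longrightarrow> (\<psi> has_vector_derivative \<psi>1 y) (at y)"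
      "\<And>y. y \<in> I \<Longrightarrow> (\<psi>1 has_vector_derivative \<psi>2 y) (at y)"
      "\<And>y. y \<in> I \<Longrightarrow> (\<psi>2 has_vector_derivative \<psi>3 y) (at y)"
    and \<psi>: "\<And>y. y \<in> I \<Longrightarrow> \<bar>\<psi>1 y\<bar> \<ge> \<mu>" "\<And>y. y \<in> I \<Longrightarrow> \<bar>\<psi>2 y\<bar> \<le> L * \<mu>"
      "\<And>y. y \<in> I \<Longrightarrow> \<bar>\<psi>3 y\<bar> \<le> L * \<mu>"
    and B: "C2_bounded M B" and B0: "\<And>y. y \<notin> I \<Longrightarrow> B y = 0"
  shows "(1 + \<mu>\<^sup>2) * cmod (\<integral>y. exp (\<i> * of_real (\<psi> y)) * B y \<partial>lborel) \<le> 2 * r * M * (2 + 4 * L + 3 * L\<^sup>2)"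
proof -
  obtain B1 B2 where dB: "\<And>y. (B has_vector_derivative B1 y) (at y)"
    "\<And>y. (B1 has_vector_derivative B2 y) (at y)"
    and Bb: "\<And>y. cmod (B y) \<le> M" "\<And>y. cmod (B1 y) \<le> M" "\<And>y. cmod (B2 y) \<le> M"
    using C2_boundedE[OF B] by metis
  have M: "M \<ge> 0" using Bb(1)[of 0] norm_ge_zero order_trans by blast
  let ?J = "\<integral>y. exp (\<i> * of_real (\<psi> y)) * B y \<partial>lborel"
  have "cmod ?J \<le> (\<integral>y. M * indicator {-r..r} y \<partial>lborel)"
  proof (rule norm_integral_le)
    show "integrable lborel (\<lambda>y. M * indicator {-r..r} y)"
      using r by (intro integrable_mult_right integrable_real_indicator) auto
    show "cmod (exp (\<i> * of_real (\<psi> y)) * B y) \<le> M * indicator {-r..r} y" for y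
      using Bb(1)[of y] B0[of y] I(3) by (cases "y \<in> I") (auto simp: norm_mult indicator_def)
  qed
  then have J1: "cmod ?J \<le> 2 * r * M" using r by (simp add: mult_ac)
  have J2: "\<mu>\<^sup>2 * cmod ?J \<le> 2 * r * M * (1 + 4 * L + 3 * L\<^sup>2)"
  proof (cases "\<mu> > 0 \<and> I \<noteq> {}")
    case True
    obtain c d where cd: "I = {c..d}"
      using connected_compact_interval_1[of I] I convex_connected by blast
    with True have "c \<le> d" by simp
    \<comment> \<open>The rays beyond the endpoints lie outside \<open>I\<close>, so the endpoints
      are limits of zeros of \<open>B\<close>, even if \<open>I\<close> is a single point.\<close>
    have "{..<c} \<subseteq> - I" "{d<..} \<subseteq> - I" by (auto simp: cd)
    then have "closure {..<c} \<subseteq> closure (- I)" "closure {d<..} \<subseteq> closure (- I)"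
      by (intro closure_mono; simp)+
    then have cc: "c \<in> closure (- I)" "d \<in> closure (- I)" by auto
    have ends: "B c = 0" "B1 c = 0" "B d = 0" "B1 d = 0"
      using derivative_zero_on_closure[OF dB _ _ cc(1)] derivative_zero_on_closure[OF dB _ _ cc(2)]
        B0 compact_imp_closed[OF I(2)] by auto
    let ?F = "\<lambda>y. exp (\<i> * of_real (\<psi> y)) * B y"
    have "continuous_on {c..d} \<psi>" "continuous_on {c..d} B"
      using d\<psi>(1) dB(1) has_vector_derivative_continuous unfolding cd
      by (blast intro: continuous_at_imp_continuous_on)+
    then have "continuous_on {c..d} ?F" by (intro continuous_intros)
    then have "(LINT y : {c..d} | lborel. ?F y) = integral {c..d} ?F"
      by (intro set_borel_integral_eq_integral borel_integrable_atLeastAtMost')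
    moreover have "?J = (LINT y : {c..d} | lborel. ?F y)"
      unfolding set_lebesgue_integral_def
      by (rule Bochner_Integration.integral_cong) (use B0 cd in \<open>auto simp: indicator_def\<close>)
    ultimately have "cmod ?J = cmod (integral {c..d} ?F)" by simp
    also have "\<dots> \<le> M * (1 + 4 * L + 3 * L\<^sup>2) / \<mu>\<^sup>2 * (d - c)"
      by (rule oscillatory_integral_by_parts[OF \<open>c \<le> d\<close> _ L d\<psi> \<psi> dB Bb])
        (use True cd ends in auto)
    also have "\<dots> \<le> M * (1 + 4 * L + 3 * L\<^sup>2) / \<mu>\<^sup>2 * (2 * r)"
      using I(3) \<open>c \<le> d\<close> M L by (intro mult_left_mono) (auto simp: cd)
    finally show ?thesis using True by (simp add: field_simps)
  next
    case False
    \<comment> \<open>If \<open>I\<close> is empty, \<open>B\<close> vanishes identically.\<close>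
    then have "\<mu> = 0 \<or> ?J = 0" using \<mu> B0 by auto
    then show ?thesis using r M L by auto
  qed
  from J1 J2 have "cmod ?J + \<mu>\<^sup>2 * cmod ?J \<le> 2 * r * M + 2 * r * M * (1 + 4 * L + 3 * L\<^sup>2)" by linarith
  then show ?thesis by (simp add: algebra_simps)
qed

section \<open>The correlation kernel\<close>

lemma smooth_onD:
  assumes "smooth_on U f"
  shows "continuous_on U (dirDs vs f)" "z \<in> U \<Longrightarrow> dirDs vs f differentiable at z" "open U"
  using assms unfolding smooth_on_def by blast+

text \<open>The complement of the support is open, so vanishing there is a local property and passes
  to each further derivative.\<close>

lemma dirDs_outside_supp:
  assumes "z \<notin> supp a"
  shows "dirDs vs a z = 0"
  using assms
proof (induction vs arbitrary: z)
  case Nil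
  then show ?case using closure_subset[of "{x. a x \<noteq> 0}"] by (auto simp: supp_def)
next
  case (Cons v vs)
  have o: "open (- supp a)" by (simp add: supp_def open_Compl)
  have "(dirDs vs a has_derivative (\<lambda>_. 0)) (at z)"
    by (rule has_derivative_transform_within_open[OF has_derivative_const o]) (use Cons in auto)
  then have "frechet_derivative (dirDs vs a) (at z) = (\<lambda>_. 0)"
    using frechet_derivative_at by metis
  then show ?case by (simp add: dirD_def)
qed

lemma dirDs_bounded_on_compact:
  assumes "smooth_on U f" "compact K" "K \<subseteq> U"
  shows "\<exists>M. \<forall>z\<in>K. norm (dirDs vs f z) \<le> M"
proof -
  have "continuous_on K (dirDs vs f)" using smooth_onD(1)[OF assms(1)] assms(3) continuous_on_subset by blast
  then have "bounded (dirDs vs f ` K)" using assms(2) compact_continuous_image compact_imp_bounded by blast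
  then show ?thesis by (auto simp: bounded_iff)
qed

lemma Cc_inf_dirDs_bounded:
  assumes "Cc_inf a"
  shows "\<exists>M. \<forall>z. norm (dirDs vs a z) \<le> M"
proof -
  obtain M where M: "\<And>z. z \<in> supp a \<Longrightarrow> norm (dirDs vs a z) \<le> M"
    using dirDs_bounded_on_compact[of UNIV a "supp a" vs] assms unfolding Cc_inf_def by auto
  have "norm (dirDs vs a z) \<le> max M 0" for z
    using M[of z] dirDs_outside_supp[of z a vs] by (cases "z \<in> supp a") auto
  then show ?thesis by blast
qed

text \<open>The bound is uniform in the base point \<open>Q\<close>, since the four lines in the
  kernel depend on x, t and s.\<close>

lemma Cc_inf_C2_bounded:
  fixes a :: "R2 \<Rightarrow> complex"
  assumes a: "Cc_inf a"
  shows "\<exists>M. \<forall>Q. C2_bounded M (\<lambda>y. a (Q + y *\<^sub>R (c *\<^sub>R v)))"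
proof -
  obtain M0 where M0: "\<And>z. cmod (dirDs [] a z) \<le> M0" using Cc_inf_dirDs_bounded[OF a] by blast
  obtain M1 where M1: "\<And>z. cmod (dirDs [v] a z) \<le> M1" using Cc_inf_dirDs_bounded[OF a] by blast
  obtain M2 where M2: "\<And>z. cmod (dirDs [v,v] a z) \<le> M2" using Cc_inf_dirDs_bounded[OF a] by blast
  have diff: "dirDs vs a differentiable at z" for vs z
    using a smooth_onD(2)[of UNIV a z vs] by (simp add: Cc_inf_def)
  define M where "M = max M0 (max (\<bar>c\<bar> * M1) (c\<^sup>2 * M2))"
  have "C2_bounded M (\<lambda>y. a (Q + y *\<^sub>R (c *\<^sub>R v)))" for Q
    unfolding C2_bounded_def
  proof (intro exI allI conjI)
    fix y
    show "((\<lambda>y. a (Q + y *\<^sub>R (c *\<^sub>R v))) has_vector_derivative c *\<^sub>R dirD v a (Q + y *\<^sub>R (c *\<^sub>R v))) (at y)"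
      by (rule has_vector_derivative_along_line) (use diff[of "[]"] in simp)
    have "((\<lambda>y. dirD v a (Q + y *\<^sub>R (c *\<^sub>R v))) has_vector_derivative
        c *\<^sub>R dirD v (dirD v a) (Q + y *\<^sub>R (c *\<^sub>R v))) (at y)"
      by (rule has_vector_derivative_along_line) (use diff[of "[v]"] in simp)
    from bounded_linear.has_vector_derivative[OF bounded_linear_scaleR_right this]
    show "((\<lambda>y. c *\<^sub>R dirD v a (Q + y *\<^sub>R (c *\<^sub>R v))) has_vector_derivative
        c *\<^sub>R c *\<^sub>R dirD v (dirD v a) (Q + y *\<^sub>R (c *\<^sub>R v))) (at y)" .
    show "cmod (a (Q + y *\<^sub>R (c *\<^sub>R v))) \<le> M" using M0[of "Q + y *\<^sub>R (c *\<^sub>R v)"] by (simp add: M_def)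
    have "cmod (c *\<^sub>R dirD v a (Q + y *\<^sub>R (c *\<^sub>R v))) \<le> \<bar>c\<bar> * M1"
      using M1[of "Q + y *\<^sub>R (c *\<^sub>R v)"] by (auto intro!: mult_left_mono)
    then show "cmod (c *\<^sub>R dirD v a (Q + y *\<^sub>R (c *\<^sub>R v))) \<le> M" by (simp only: M_def le_max_iff_disj) simp
    have "cmod (c *\<^sub>R c *\<^sub>R dirD v (dirD v a) (Q + y *\<^sub>R (c *\<^sub>R v))) \<le> c\<^sup>2 * M2"
      using mult_left_mono[OF M2[of "Q + y *\<^sub>R (c *\<^sub>R v)"], of "c\<^sup>2"] by (simp add: power2_eq_square abs_mult[symmetric])
    then show "cmod (c *\<^sub>R c *\<^sub>R dirD v (dirD v a) (Q + y *\<^sub>R (c *\<^sub>R v))) \<le> M" by (simp only: M_def le_max_iff_disj) simp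
  qed
  then show ?thesis by blast
qed

lemma line_section:
  fixes K :: "R2 set"
  shows "convex K \<Longrightarrow> convex {y. X + y *\<^sub>R w \<in> K}"
    and "closed K \<Longrightarrow> closed {y. X + y *\<^sub>R w \<in> K}"
proof -
  assume K: "convex K"
  show "convex {y. X + y *\<^sub>R w \<in> K}"
  proof (rule convexI)
    fix x y u v :: real
    assume *: "x \<in> {y. X + y *\<^sub>R w \<in> K}" "y \<in> {y. X + y *\<^sub>R w \<in> K}" "0 \<le> u" "0 \<le> v" "u + v = 1"
    have "u *\<^sub>R (X + x *\<^sub>R w) + v *\<^sub>R (X + y *\<^sub>R w) \<in> K" using * K by (intro convexD) auto
    moreover have "u *\<^sub>R (X + x *\<^sub>R w) + v *\<^sub>R (X + y *\<^sub>R w) = (u + v) *\<^sub>R X + (u * x + v * y) *\<^sub>R w"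
      by (simp add: algebra_simps)
    ultimately show "u *\<^sub>R x + v *\<^sub>R y \<in> {y. X + y *\<^sub>R w \<in> K}" using * by simp
  qed
next
  assume "closed K"
  then have "closed ((\<lambda>y. X + y *\<^sub>R w) -` K)"
    by (intro continuous_closed_vimage) (auto intro!: continuous_intros)
  then show "closed {y. X + y *\<^sub>R w \<in> K}" by (simp add: vimage_def)
qed

text \<open>At fixed y the four factors sit at the vertices of a parallelogram with sides
  \<open>t *\<^sub>R (w2 - w3)\<close>, parallel to \<open>v1\<close>, and
  \<open>s *\<^sub>R w2\<close>, parallel to \<open>v2\<close>; increasing y translates it along
  \<open>w3\<close>. The phase is \<open>lam\<close> times the second difference of \<open>S\<close>
  over the vertices, so its y-derivative is \<open>lam * s * t\<close> times a third-order
  derivative of \<open>S\<close>, up to the constants \<open>c1\<close>, \<open>c2\<close>,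
  \<open>c3\<close>.\<close>

lemma correlation_kernel_bound:
  fixes a :: "R2 \<Rightarrow> complex" and S :: "R2 \<Rightarrow> real"
  assumes a: "Cc_inf a" and U: "convex hull (supp a) \<subseteq> U" and S: "smooth_on U S"
    and lower: "\<forall>z\<in>convex hull (supp a). \<bar>dirD v1 (dirD v2 (dirD v3 S)) z\<bar> \<ge> 1"
    and w: "w2 = c2 *\<^sub>R v2" "w3 = c3 *\<^sub>R v3" "w2 - w3 = c1 *\<^sub>R v1" and c: "c1 \<noteq> 0" "c2 \<noteq> 0" "c3 \<noteq> 0"
    and r: "r \<ge> 0" "\<And>x y. x *\<^sub>R w2 + y *\<^sub>R w3 \<in> convex hull (supp a) \<Longrightarrow> \<bar>y\<bar> \<le> r"
  defines "A \<equiv> \<lambda>lam (x, y). exp (\<i> * of_real (lam * S (x *\<^sub>R w2 + y *\<^sub>R w3))) * a (x *\<^sub>R w2 + y *\<^sub>R w3)"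
  shows "\<exists>C\<ge>0. \<forall>lam t x s. cmod (\<integral>y. A lam (x,y) * cnj (A lam (x+t,y-t)) *
        cnj (A lam (x+s,y) * cnj (A lam (x+s+t,y-t))) \<partial>lborel) \<le> C / (1 + (\<bar>lam\<bar> * \<bar>t\<bar> * s)\<^sup>2)"
proof -
  define K where "K = convex hull (supp a)"
  have K: "convex K" "compact K" "K \<subseteq> U"
    using a U by (auto simp: K_def Cc_inf_def compact_convex_hull)
  have suppK: "z \<in> K" if "a z \<noteq> 0" for z
    using that closure_subset[of "{x. a x \<noteq> 0}"] hull_subset[of "supp a" convex] by (auto simp: K_def supp_def)
  obtain M where M: "\<And>Q. C2_bounded M (\<lambda>y. a (Q + y *\<^sub>R w3))"
    using Cc_inf_C2_bounded[OF a, of c3 v3] unfolding w by blast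
  obtain M2 where M2: "\<And>z. z \<in> K \<Longrightarrow> \<bar>dirDs [v1, v2, v3, v3] S z\<bar> \<le> M2"
    using dirDs_bounded_on_compact[OF S K(2,3)] unfolding real_norm_def by blast
  obtain M3 where M3: "\<And>z. z \<in> K \<Longrightarrow> \<bar>dirDs [v1, v2, v3, v3, v3] S z\<bar> \<le> M3"
    using dirDs_bounded_on_compact[OF S K(2,3)] unfolding real_norm_def by blast
  \<comment> \<open>Each further y-derivative of the phase brings one more factor \<open>c3\<close>
    and one more derivative along \<open>v3\<close>. The maximum with 0 covers an empty
    \<open>K\<close>, where \<open>M2\<close> and \<open>M3\<close> are arbitrary.\<close>
  define L where "L = max 0 (max (\<bar>c3\<bar> * M2) (c3\<^sup>2 * M3))"
  have L: "L \<ge> 0" "\<bar>c3\<bar> * M2 \<le> L" "c3\<^sup>2 * M3 \<le> L" by (auto simp: L_def)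
  \<comment> \<open>The four cutoffs are multiplied in two pairs, and then the pairs with each
    other.\<close>
  define N where "N = 4 * (4 * M * M) * (4 * M * M)"
  define E where "E = 2 * r * N * (2 + 4 * L + 3 * L\<^sup>2)"
  \<comment> \<open>Conversion factor between the size of the phase derivative and
    \<open>\<bar>lam\<bar> * \<bar>t\<bar> * s\<close>.\<close>
  define \<gamma> where "\<gamma> = \<bar>c1 * c2 * c3\<bar>"
  have \<gamma>: "\<gamma> > 0" using c by (simp add: \<gamma>_def)
  have main: "(1 + (\<gamma> * (\<bar>lam\<bar> * \<bar>t\<bar> * s))\<^sup>2) * cmod (\<integral>y. A lam (x,y) * cnj (A lam (x+t,y-t)) *
        cnj (A lam (x+s,y) * cnj (A lam (x+s+t,y-t))) \<partial>lborel) \<le> E" for lam t x s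
  proof -
    define Q where "Q = x *\<^sub>R w2"
    define \<sigma> where "\<sigma> = s * c2"
    define \<tau> where "\<tau> = t * c1"
    define Q1 where "Q1 = Q + \<tau> *\<^sub>R v1"
    define Q2 where "Q2 = Q + \<sigma> *\<^sub>R v2"
    define Q3 where "Q3 = Q + \<tau> *\<^sub>R v1 + \<sigma> *\<^sub>R v2"
    have sw: "s *\<^sub>R w2 = \<sigma> *\<^sub>R v2" by (simp add: \<sigma>_def w)
    have tw: "t *\<^sub>R (w2 - w3) = \<tau> *\<^sub>R v1" by (simp add: \<tau>_def w(3))
    have coords: "x *\<^sub>R w2 + y *\<^sub>R w3 = Q + y *\<^sub>R w3"
      "(x + t) *\<^sub>R w2 + (y - t) *\<^sub>R w3 = Q1 + y *\<^sub>R w3"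
      "(x + s) *\<^sub>R w2 + y *\<^sub>R w3 = Q2 + y *\<^sub>R w3"
      "(x + s + t) *\<^sub>R w2 + (y - t) *\<^sub>R w3 = Q3 + y *\<^sub>R w3" for y
      unfolding Q_def Q1_def Q2_def Q3_def sw[symmetric] tw[symmetric] by (simp_all add: algebra_simps)
    define D where "D = (\<lambda>g y. g (Q + y *\<^sub>R w3) - g (Q1 + y *\<^sub>R w3) - g (Q2 + y *\<^sub>R w3) + g (Q3 + y *\<^sub>R w3) :: real)"
    \<comment> \<open>Those y for which the whole parallelogram lies in \<open>K\<close>. Outside
      \<open>I\<close> one of the four cutoffs vanishes; inside, the mean value theorem applies. As
      an intersection of sections of a compact convex set, \<open>I\<close> is a compact
      interval.\<close>
    define I where "I = {y. Q + y *\<^sub>R w3 \<in> K} \<inter> {y. Q1 + y *\<^sub>R w3 \<in> K} \<inter> {y. Q2 + y *\<^sub>R w3 \<in> K} \<inter> {y. Q3 + y *\<^sub>R w3 \<in> K}"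
    define B where "B = (\<lambda>y. (a (Q + y *\<^sub>R w3) * cnj (a (Q1 + y *\<^sub>R w3))) * cnj (a (Q2 + y *\<^sub>R w3) * cnj (a (Q3 + y *\<^sub>R w3))))"
    define G where "G = (\<lambda>k. dirDs (replicate k v3) S)"
    have I: "I \<subseteq> {-r..r}"
    proof
      fix y assume "y \<in> I"
      then have "x *\<^sub>R w2 + y *\<^sub>R w3 \<in> convex hull (supp a)" by (auto simp: I_def Q_def K_def)
      from r(2)[OF this] show "y \<in> {-r..r}" by auto
    qed
    have Icv: "convex I" unfolding I_def by (intro convex_Int line_section K)
    have Icl: "closed I" unfolding I_def by (intro closed_Int line_section compact_imp_closed K)
    have Icp: "compact I"
      using Icl I bounded_subset[OF bounded_closed_interval] by (auto simp: compact_eq_bounded_closed)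
    have dG: "((\<lambda>y. G k (X + y *\<^sub>R w3)) has_vector_derivative c3 * G (Suc k) (X + y *\<^sub>R w3)) (at y)"
      if "X + y *\<^sub>R w3 \<in> K" for k X y
    proof -
      have "G k differentiable at (X + y *\<^sub>R (c3 *\<^sub>R v3))"
        unfolding G_def by (rule smooth_onD(2)[OF S]) (use K(3) that in \<open>auto simp: w\<close>)
      from has_vector_derivative_along_line[OF this] show ?thesis by (simp add: G_def w)
    qed
    have dD: "((\<lambda>y. C * D (G k) y) has_vector_derivative (C * c3) * D (G (Suc k)) y) (at y)" if "y \<in> I" for y k C
    proof -
      have "((\<lambda>y. D (G k) y) has_vector_derivative c3 * G (Suc k) (Q + y *\<^sub>R w3) - c3 * G (Suc k) (Q1 + y *\<^sub>R w3)
          - c3 * G (Suc k) (Q2 + y *\<^sub>R w3) + c3 * G (Suc k) (Q3 + y *\<^sub>R w3)) (at y)"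
        unfolding D_def using that unfolding I_def
        by (intro has_vector_derivative_add has_vector_derivative_diff dG) auto
      from has_vector_derivative_mult_right[OF this, of C] show ?thesis by (simp add: D_def algebra_simps)
    qed
    \<comment> \<open>Second differences commute with differentiation in y, so one statement for all
      \<open>k\<close> covers the phase derivatives of every order.\<close>
    have mvt: "\<exists>\<xi>\<in>K. D (G k) y = \<sigma> * \<tau> * dirDs (v1 # v2 # replicate k v3) S \<xi>" if y: "y \<in> I" for y k
    proof -
      have "\<exists>\<xi>\<in>K. G k (Q + y *\<^sub>R w3) - G k ((Q + y *\<^sub>R w3) + \<tau> *\<^sub>R v1) - G k ((Q + y *\<^sub>R w3) + \<sigma> *\<^sub>R v2)
         + G k ((Q + y *\<^sub>R w3) + \<tau> *\<^sub>R v1 + \<sigma> *\<^sub>R v2) = \<sigma> * \<tau> * dirD v1 (dirD v2 (G k)) \<xi>"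
      proof (rule second_difference_mvt[OF K(1)])
        show "G k differentiable at z" if "z \<in> K" for z
          unfolding G_def by (rule smooth_onD(2)[OF S]) (use K(3) that in auto)
        show "dirD v2 (G k) differentiable at z" if "z \<in> K" for z
          unfolding G_def using smooth_onD(2)[OF S, of z "v2 # replicate k v3"] subsetD[OF K(3) that] by simp
      qed (use y in \<open>auto simp: I_def Q1_def Q2_def Q3_def algebra_simps\<close>)
      then show ?thesis by (simp add: D_def G_def Q1_def Q2_def Q3_def add_ac)
    qed
    define \<mu> where "\<mu> = \<bar>lam * c3\<bar> * \<bar>\<sigma> * \<tau>\<bar>"
    have \<mu>0: "\<mu> \<ge> 0" by (simp add: \<mu>_def)
    have b1: "\<bar>(lam * c3) * D (G (Suc 0)) y\<bar> \<ge> \<mu>" if y: "y \<in> I" for y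
    proof -
      obtain \<xi> where "\<xi> \<in> K" "D (G (Suc 0)) y = \<sigma> * \<tau> * dirD v1 (dirD v2 (dirD v3 S)) \<xi>"
        using mvt[OF y, of "Suc 0"] by auto
      then show ?thesis using mult_left_mono[OF lower[rule_format, of \<xi>] \<mu>0] by (simp add: abs_mult \<mu>_def K_def mult_ac)
    qed
    have b2: "\<bar>(lam * c3 * c3) * D (G (Suc (Suc 0))) y\<bar> \<le> L * \<mu>" if y: "y \<in> I" for y
    proof -
      obtain \<xi> where \<xi>: "\<xi> \<in> K" "D (G (Suc (Suc 0))) y = \<sigma> * \<tau> * dirDs [v1,v2,v3,v3] S \<xi>"
        using mvt[OF y, of "Suc (Suc 0)"] by auto
      have "\<bar>(lam * c3 * c3) * D (G (Suc (Suc 0))) y\<bar> = \<mu> * (\<bar>c3\<bar> * \<bar>dirDs [v1,v2,v3,v3] S \<xi>\<bar>)"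
        unfolding \<xi>(2) \<mu>_def abs_mult by (simp only: mult_ac)
      also have "\<dots> \<le> \<mu> * (\<bar>c3\<bar> * M2)" by (intro mult_left_mono M2 \<xi> \<mu>0) simp
      also have "\<dots> \<le> \<mu> * L" by (intro mult_left_mono L \<mu>0)
      finally show ?thesis by (simp add: mult.commute)
    qed
    have b3: "\<bar>(lam * c3 * c3 * c3) * D (G (Suc (Suc (Suc 0)))) y\<bar> \<le> L * \<mu>" if y: "y \<in> I" for y
    proof -
      obtain \<xi> where \<xi>: "\<xi> \<in> K" "D (G (Suc (Suc (Suc 0)))) y = \<sigma> * \<tau> * dirDs [v1,v2,v3,v3,v3] S \<xi>"
        using mvt[OF y, of "Suc (Suc (Suc 0))"] by auto
      have "\<bar>(lam * c3 * c3 * c3) * D (G (Suc (Suc (Suc 0)))) y\<bar> = \<mu> * ((\<bar>c3\<bar> * \<bar>c3\<bar>) * \<bar>dirDs [v1,v2,v3,v3,v3] S \<xi>\<bar>)"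
        unfolding \<xi>(2) \<mu>_def abs_mult by (simp only: mult_ac)
      also have "\<dots> \<le> \<mu> * ((\<bar>c3\<bar> * \<bar>c3\<bar>) * M3)" by (intro mult_left_mono M3 \<xi> \<mu>0) simp
      also have "\<dots> \<le> \<mu> * L" using L(3) by (intro mult_left_mono \<mu>0) (simp add: power2_eq_square)
      finally show ?thesis by (simp add: mult.commute)
    qed
    have BC: "C2_bounded N B"
      unfolding B_def N_def by (intro C2_bounded_mult C2_bounded_cnj M)
    have a0: "a z = 0" if "z \<notin> K" for z using suppK[of z] that by blast
    have B0: "B y = 0" if "y \<notin> I" for y using that by (auto simp: I_def B_def a0)
    have "(1 + \<mu>\<^sup>2) * cmod (\<integral>y. exp (\<i> * of_real (lam * D (G 0) y)) * B y \<partial>lborel) \<le> E"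
      unfolding E_def
      by (rule oscillatory_integral_decay[OF Icv Icp I r(1) \<mu>0 L(1) dD dD dD b1 b2 b3 BC B0])
    moreover have "A lam (x,y) * cnj (A lam (x+t,y-t)) * cnj (A lam (x+s,y) * cnj (A lam (x+s+t,y-t)))
        = exp (\<i> * of_real (lam * D (G 0) y)) * B y" for y
    proof -
      \<comment> \<open>Conjugation gives the two middle vertices a minus sign; the last one is
        conjugated twice and keeps its plus sign.\<close>
      have e: "exp (\<i> * of_real (lam * (p - q - u + v))) = exp (\<i> * of_real (lam * p)) * cnj (exp (\<i> * of_real (lam * q)))
          * cnj (exp (\<i> * of_real (lam * u)) * cnj (exp (\<i> * of_real (lam * v))))" for p q u v :: real
        by (simp add: exp_cnj exp_add[symmetric] algebra_simps)
      show ?thesis unfolding A_def case_prod_conv coords D_def G_def B_def e by (simp add: mult_ac)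
    qed
    moreover have "\<mu>\<^sup>2 = (\<gamma> * (\<bar>lam\<bar> * \<bar>t\<bar> * s))\<^sup>2"
      by (simp add: \<mu>_def \<gamma>_def \<sigma>_def \<tau>_def power_mult_distrib abs_mult mult_ac)
    ultimately show ?thesis by simp
  qed
  have E0: "E \<ge> 0"
    \<comment> \<open>Any choice of parameters shows that \<open>E\<close> dominates a nonnegative
      number.\<close>
    by (rule order_trans[OF _ main[of 0 0 0 0]]) simp
  show ?thesis
  \<comment> \<open>From (1 + \<gamma>^2 V) X \<le> E follow both X \<le> E and V X \<le> E /
    \<gamma>^2; their sum is the claim without \<gamma> in the denominator's weight.\<close>
  proof (intro exI[of _ "E * (1 + 1 / \<gamma>\<^sup>2)"] conjI allI)
    show "0 \<le> E * (1 + 1 / \<gamma>\<^sup>2)" using E0 by simp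
    fix lam t x s :: real
    define V where "V = (\<bar>lam\<bar> * \<bar>t\<bar> * s)\<^sup>2"
    define X where "X = cmod (\<integral>y. A lam (x,y) * cnj (A lam (x+t,y-t)) *
        cnj (A lam (x+s,y) * cnj (A lam (x+s+t,y-t))) \<partial>lborel)"
    have V: "V \<ge> 0" and X: "X \<ge> 0" by (simp_all add: V_def X_def)
    have "(1 + \<gamma>\<^sup>2 * V) * X \<le> E"
      using main[of lam t s x] unfolding V_def X_def power_mult_distrib[of \<gamma>] .
    then have m: "X + \<gamma>\<^sup>2 * (V * X) \<le> E" by (simp only: distrib_right mult_1_left mult.assoc)
    have g: "0 \<le> \<gamma>\<^sup>2 * (V * X)" using V X by simp
    have x1: "X \<le> E" using m g by linarith
    have "\<gamma>\<^sup>2 * (V * X) \<le> E" using m X by linarith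
    then have "V * X \<le> E / \<gamma>\<^sup>2" using \<gamma> by (simp add: pos_le_divide_eq mult.commute)
    with x1 have "X + V * X \<le> E + E / \<gamma>\<^sup>2" by (rule add_mono)
    then have "X * (1 + V) \<le> E * (1 + 1 / \<gamma>\<^sup>2)" by (simp add: distrib_left mult.commute)
    moreover have "0 < 1 + V" using V by linarith
    ultimately have "X \<le> E * (1 + 1 / \<gamma>\<^sup>2) / (1 + V)" by (simp only: pos_le_divide_eq)
    then show "cmod (\<integral>y. A lam (x,y) * cnj (A lam (x+t,y-t)) *
        cnj (A lam (x+s,y) * cnj (A lam (x+s+t,y-t))) \<partial>lborel) \<le> E * (1 + 1 / \<gamma>\<^sup>2) / (1 + (\<bar>lam\<bar> * \<bar>t\<bar> * s)\<^sup>2)"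
      unfolding X_def V_def .
  qed
qed

section \<open>Linear coordinates and truncation\<close>

text \<open>The linear map is factored into two one-variable affine substitutions: in the second
  coordinate with the first fixed (Jacobian \<open>k\<close>), then in the first with the new second
  coordinate fixed (Jacobian \<open>p\<close>). Their product is the determinant.\<close>

lemma nn_integral_linear_coordinates_aux:
  fixes f :: "R2 \<Rightarrow> ennreal"
  assumes f: "f \<in> borel_measurable borel" and p: "p \<noteq> 0" and det: "p * s - q * r \<noteq> 0"
  shows "(\<integral>\<^sup>+z. f z \<partial>lborel) =
    \<bar>p * s - q * r\<bar> * (\<integral>\<^sup>+y. (\<integral>\<^sup>+x. f (x *\<^sub>R (p, q) + y *\<^sub>R (r, s)) \<partial>lborel) \<partial>lborel)"
proof -
  have [measurable]: "f \<in> borel_measurable (borel \<Otimes>\<^sub>M borel)" using f by (simp add: borel_prod)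
  define k where "k = (p * s - q * r) / p"
  have k: "k \<noteq> 0" using p det by (simp add: k_def)
  have pk: "\<bar>k\<bar> * \<bar>p\<bar> = \<bar>p * s - q * r\<bar>" using p by (simp add: k_def)
  have "(\<integral>\<^sup>+z. f z \<partial>lborel) = (\<integral>\<^sup>+x. (\<integral>\<^sup>+y. f (x, y) \<partial>lborel) \<partial>lborel)"
    using f by (subst lborel.nn_integral_fst) (auto simp: lborel_prod)
  also have "\<dots> = (\<integral>\<^sup>+x. \<bar>k\<bar> * (\<integral>\<^sup>+y. f (x, q / p * x + k * y) \<partial>lborel) \<partial>lborel)"
    by (intro nn_integral_cong nn_integral_real_affine k) measurable
  also have "\<dots> = \<bar>k\<bar> * (\<integral>\<^sup>+x. (\<integral>\<^sup>+y. f (x, q / p * x + k * y) \<partial>lborel) \<partial>lborel)"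
    by (rule nn_integral_cmult) measurable
  also have "(\<integral>\<^sup>+x. (\<integral>\<^sup>+y. f (x, q / p * x + k * y) \<partial>lborel) \<partial>lborel) =
      (\<integral>\<^sup>+y. (\<integral>\<^sup>+x. f (x, q / p * x + k * y) \<partial>lborel) \<partial>lborel)"
    by (rule lborel_pair.Fubini'[symmetric]) measurable
  also have "\<dots> = (\<integral>\<^sup>+y. \<bar>p\<bar> * (\<integral>\<^sup>+x. f (x *\<^sub>R (p, q) + y *\<^sub>R (r, s)) \<partial>lborel) \<partial>lborel)"
  proof (rule nn_integral_cong)
    fix y
    have eq: "(r * y + p * x, q / p * (r * y + p * x) + k * y) = x *\<^sub>R (p, q) + y *\<^sub>R (r, s)" for x
      using p by (simp add: k_def field_simps)
    have "(\<integral>\<^sup>+x. f (x, q / p * x + k * y) \<partial>lborel) =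
        \<bar>p\<bar> * (\<integral>\<^sup>+x. f (r * y + p * x, q / p * (r * y + p * x) + k * y) \<partial>lborel)"
      by (rule nn_integral_real_affine[OF _ p]) measurable
    then show "(\<integral>\<^sup>+x. f (x, q / p * x + k * y) \<partial>lborel) = \<bar>p\<bar> * (\<integral>\<^sup>+x. f (x *\<^sub>R (p, q) + y *\<^sub>R (r, s)) \<partial>lborel)"
      by (simp only: eq)
  qed
  also have "\<dots> = \<bar>p\<bar> * (\<integral>\<^sup>+y. (\<integral>\<^sup>+x. f (x *\<^sub>R (p, q) + y *\<^sub>R (r, s)) \<partial>lborel) \<partial>lborel)"
    by (rule nn_integral_cmult) (simp, measurable)
  finally show ?thesis
    by (simp add: mult.assoc[symmetric] ennreal_mult[symmetric] pk)
qed

text \<open>If the first component of \<open>u\<close> is zero, that of \<open>v\<close> is not, and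
  the two vectors exchange roles.\<close>

lemma nn_integral_linear_coordinates:
  fixes f :: "R2 \<Rightarrow> ennreal" and u v :: R2
  assumes f: "f \<in> borel_measurable borel" and det: "fst u * snd v - snd u * fst v \<noteq> 0"
  shows "(\<integral>\<^sup>+z. f z \<partial>lborel) =
    \<bar>fst u * snd v - snd u * fst v\<bar> * (\<integral>\<^sup>+p. f (fst p *\<^sub>R u + snd p *\<^sub>R v) \<partial>lborel)"
proof -
  have [measurable]: "f \<in> borel_measurable (borel \<Otimes>\<^sub>M borel)" using f by (simp add: borel_prod)
  have m: "(\<lambda>p. f (fst p *\<^sub>R u + snd p *\<^sub>R v)) \<in> borel_measurable (lborel \<Otimes>\<^sub>M lborel)"
    by (cases u, cases v) simp
  have 1: "(\<integral>\<^sup>+p. f (fst p *\<^sub>R u + snd p *\<^sub>R v) \<partial>lborel) =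
      (\<integral>\<^sup>+x. (\<integral>\<^sup>+y. f (x *\<^sub>R u + y *\<^sub>R v) \<partial>lborel) \<partial>lborel)"
    using lborel.nn_integral_fst[OF m] by (simp add: lborel_prod)
  have 2: "(\<integral>\<^sup>+p. f (fst p *\<^sub>R u + snd p *\<^sub>R v) \<partial>lborel) =
      (\<integral>\<^sup>+y. (\<integral>\<^sup>+x. f (x *\<^sub>R u + y *\<^sub>R v) \<partial>lborel) \<partial>lborel)"
    using lborel_pair.nn_integral_snd[OF m] by (simp add: lborel_prod)
  show ?thesis
  proof (cases "fst u = 0")
    case False
    then show ?thesis
      unfolding 2 using nn_integral_linear_coordinates_aux[OF f False, of "snd v" "snd u" "fst v"] det by simp
  next
    case True
    then have "fst v \<noteq> 0" using det by auto
    then show ?thesis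
      unfolding 1 using nn_integral_linear_coordinates_aux[OF f, of "fst v" "snd u" "snd v" "fst u"] det
      by (simp add: add.commute abs_minus_commute mult.commute)
  qed
qed

text \<open>Phrased as an identity between Lebesgue measure and a weighted push-forward, the formula
  passes to Bochner integrals of all measurable functions, integrable or not.\<close>

lemma integral_linear_coordinates:
  fixes f :: "R2 \<Rightarrow> complex" and u v :: R2
  assumes f: "f \<in> borel_measurable borel" and det: "fst u * snd v - snd u * fst v \<noteq> 0"
  shows "(\<integral>z. f z \<partial>lborel) =
    \<bar>fst u * snd v - snd u * fst v\<bar> *\<^sub>R (\<integral>p. f (fst p *\<^sub>R u + snd p *\<^sub>R v) \<partial>lborel)"
proof -
  let ?T = "\<lambda>p. fst p *\<^sub>R u + snd p *\<^sub>R v" and ?d = "\<bar>fst u * snd v - snd u * fst v\<bar>"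
  have T: "?T \<in> borel_measurable borel"
    by (intro borel_measurable_continuous_onI continuous_intros)
  have "lborel = density (distr lborel borel ?T) (\<lambda>_. ennreal ?d)"
  proof (rule measure_eqI)
    fix X :: "R2 set" assume "X \<in> sets lborel"
    then have X[measurable]: "X \<in> sets borel" by simp
    have "emeasure lborel X = (\<integral>\<^sup>+z. indicator X z \<partial>lborel)" by simp
    also have "\<dots> = ?d * (\<integral>\<^sup>+p. indicator X (?T p) \<partial>lborel)"
      by (rule nn_integral_linear_coordinates[OF _ det]) simp
    also have "(\<integral>\<^sup>+p. indicator X (?T p) \<partial>lborel) = (\<integral>\<^sup>+z. indicator X z \<partial>distr lborel borel ?T)"
      by (rule nn_integral_distr[symmetric]) (use T in auto)
    also have "ennreal ?d * \<dots> = emeasure (density (distr lborel borel ?T) (\<lambda>_. ennreal ?d)) X"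
      by (simp add: emeasure_density nn_integral_cmult)
    finally show "emeasure lborel X = emeasure (density (distr lborel borel ?T) (\<lambda>_. ennreal ?d)) X" .
  qed simp
  then have "(\<integral>z. f z \<partial>lborel) = (\<integral>z. f z \<partial>density (distr lborel borel ?T) (\<lambda>_. ennreal ?d))"
    by simp
  also have "\<dots> = ?d *\<^sub>R (\<integral>p. f (?T p) \<partial>lborel)"
    using f T by (simp add: integral_density integral_distr)
  finally show ?thesis .
qed

text \<open>Cutting both argument and value lands in \<open>bbs\<close>. At each point the sequence
  is eventually constant, and moduli never increase.\<close>

definition truncate :: "nat \<Rightarrow> (real \<Rightarrow> complex) \<Rightarrow> real \<Rightarrow> complex" where
  "truncate n f x = (if \<bar>x\<bar> \<le> n \<and> cmod (f x) \<le> n then f x else 0)"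

lemma bbs_truncate:
  assumes [measurable]: "f \<in> borel_measurable borel"
  shows "bbs (truncate n f)"
proof (rule bbsI[where M=n and R=n])
  show "truncate n f \<in> borel_measurable borel" unfolding truncate_def by measurable
qed (auto simp: truncate_def split: if_splits)

lemma cmod_truncate_le: "cmod (truncate n f x) \<le> cmod (f x)"
  by (simp add: truncate_def)

lemma eventually_truncate_eq: "\<forall>\<^sub>F n in sequentially. truncate n f x = f x"
proof -
  obtain N :: nat where "max \<bar>x\<bar> (cmod (f x)) \<le> N" using real_arch_simple by blast
  then have "truncate n f x = f x" if "n \<ge> N" for n using that by (auto simp: truncate_def)
  then show ?thesis unfolding eventually_sequentially by blast
qed

lemma L2norm_truncate_le:
  assumes "f \<in> L2" shows "L2norm (truncate n f) \<le> L2norm f"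
proof -
  have "f \<in> borel_measurable borel" using assms by (simp add: L2_def)
  from bbs_square_integrable[OF bbs_truncate[OF this]] show ?thesis
    unfolding L2norm_def using assms
    by (intro real_sqrt_le_mono integral_mono power_mono cmod_truncate_le) (auto simp: L2_def)
qed

lemma trilinear_form_L2_bound:
  fixes A :: "real \<times> real \<Rightarrow> complex" and f g h :: "real \<Rightarrow> complex"
  assumes A: "bbs A" and f: "f \<in> L2" and g: "g \<in> L2" and h: "h \<in> L2"
    and C: "C \<ge> 0" and \<nu>: "\<nu> > 0" and M: "\<And>p. cmod (A p) \<le> M"
    and kernel: "\<And>t x s. t \<noteq> 0 \<Longrightarrow> cmod (\<integral>y. A (x,y) * cnj (A (x+t,y-t)) *
        cnj (A (x+s,y) * cnj (A (x+s+t,y-t))) \<partial>lborel) \<le> C / (1 + (\<nu> * \<bar>t\<bar> * s)\<^sup>2)"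
  shows "cmod (\<integral>p. A p * f (fst p) * g (snd p) * h (fst p + snd p) \<partial>lborel)
    \<le> sqrt (2 * M\<^sup>2 + sqrt (C * pi)) * \<nu> powr (-1/6) * L2norm f * L2norm g * L2norm h" (is "_ \<le> ?b")
proof -
  define \<Psi> where "\<Psi> = (\<lambda>f g h p. A p * f (fst p) * g (snd p) * h (fst p + snd p))"
  have meas[measurable]: "f \<in> borel_measurable borel" "g \<in> borel_measurable borel" "h \<in> borel_measurable borel"
    using f g h by (auto simp: L2_def)
  have \<Psi>_meas: "\<Psi> f g h \<in> borel_measurable lborel"
    if [measurable]: "f \<in> borel_measurable borel" "g \<in> borel_measurable borel" "h \<in> borel_measurable borel" for f g h
  proof -
    have [measurable]: "A \<in> borel_measurable (borel \<Otimes>\<^sub>M borel)" using bbs_measurable[OF A] by (simp add: borel_prod)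
    have "\<Psi> f g h \<in> borel_measurable (borel \<Otimes>\<^sub>M borel)" unfolding \<Psi>_def by measurable
    then show ?thesis by (simp add: borel_prod)
  qed
  define K where "K = sqrt (2 * M\<^sup>2 + sqrt (C * pi)) * \<nu> powr (-1/6)"
  have K: "K \<ge> 0" using C by (simp add: K_def)
  have b: "?b \<ge> 0" using K by (simp add: K_def)
  have trunc: "cmod (integral\<^sup>L lborel (\<Psi> (truncate n f) (truncate n g) (truncate n h))) \<le> ?b" for n
  proof -
    let ?f = "truncate n f" and ?g = "truncate n g" and ?h = "truncate n h"
    have bb: "bbs ?f" "bbs ?g" "bbs ?h" by (intro bbs_truncate meas)+
    have "bbs (\<Psi> ?f ?g ?h)"
    proof -
      have "bbs (\<lambda>p. A p * (?f (fst p) * ?g (snd p) * ?h (fst p + snd p)))"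
      proof (rule bbs_mult_bounded[OF A, where M="real n * n * n"])
        have [measurable]: "?f \<in> borel_measurable borel" "?g \<in> borel_measurable borel" "?h \<in> borel_measurable borel"
          using bb by (auto intro: bbs_measurable)
        have "(\<lambda>p. ?f (fst p) * ?g (snd p) * ?h (fst p + snd p)) \<in> borel_measurable (borel \<Otimes>\<^sub>M borel)" by measurable
        then show "(\<lambda>p. ?f (fst p) * ?g (snd p) * ?h (fst p + snd p)) \<in> borel_measurable borel"
          by (simp add: borel_prod)
        have "cmod (truncate n k x) \<le> n" for k x by (simp add: truncate_def)
        then show "cmod (?f (fst p) * ?g (snd p) * ?h (fst p + snd p)) \<le> real n * n * n" for p :: "real \<times> real"
          unfolding norm_mult by (intro mult_mono) auto
      qed
      then show ?thesis by (simp add: \<Psi>_def mult.assoc)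
    qed
    from bbs_integral[OF this]
    have "integral\<^sup>L lborel (\<Psi> ?f ?g ?h) = (\<integral>x. (\<integral>y. A (x,y) * ?f x * ?g y * ?h (x+y) \<partial>lborel) \<partial>lborel)"
      by (simp add: \<Psi>_def)
    then have "cmod (integral\<^sup>L lborel (\<Psi> ?f ?g ?h)) \<le> K * L2norm ?f * L2norm ?g * L2norm ?h"
      unfolding K_def using trilinear_form_bbs_bound[OF A bb C \<nu> M kernel] by simp
    also have "\<dots> \<le> K * L2norm f * L2norm g * L2norm h"
      by (intro mult_mono L2norm_truncate_le f g h) (use K in auto)
    finally show ?thesis by (simp add: K_def)
  qed
  show ?thesis
  proof (cases "integrable lborel (\<Psi> f g h)")
    case True
    have "(\<lambda>n. integral\<^sup>L lborel (\<Psi> (truncate n f) (truncate n g) (truncate n h))) \<longlonglongrightarrow> integral\<^sup>L lborel (\<Psi> f g h)"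
    proof (rule integral_dominated_convergence)
      \<comment> \<open>The untruncated integrand is its own majorant.\<close>
      show "integrable lborel (\<lambda>p. cmod (\<Psi> f g h p))" using True by simp
      show "\<Psi> f g h \<in> borel_measurable lborel" by (intro \<Psi>_meas meas)
      show "\<Psi> (truncate n f) (truncate n g) (truncate n h) \<in> borel_measurable lborel" for n
        by (intro \<Psi>_meas bbs_measurable bbs_truncate meas)
      show "AE p in lborel. cmod (\<Psi> (truncate n f) (truncate n g) (truncate n h) p) \<le> cmod (\<Psi> f g h p)" for n
        unfolding \<Psi>_def norm_mult by (intro AE_I2 mult_mono cmod_truncate_le) auto
      show "AE p in lborel. (\<lambda>n. \<Psi> (truncate n f) (truncate n g) (truncate n h) p) \<longlonglongrightarrow> \<Psi> f g h p"
      proof (rule AE_I2)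
        fix p
        have "\<forall>\<^sub>F n in sequentially. \<Psi> (truncate n f) (truncate n g) (truncate n h) p = \<Psi> f g h p"
          using eventually_truncate_eq[of f "fst p"] eventually_truncate_eq[of g "snd p"]
            eventually_truncate_eq[of h "fst p + snd p"]
          by eventually_elim (simp add: \<Psi>_def)
        then show "(\<lambda>n. \<Psi> (truncate n f) (truncate n g) (truncate n h) p) \<longlonglongrightarrow> \<Psi> f g h p"
          by (rule tendsto_eventually)
      qed
    qed
    then have "(\<lambda>n. cmod (integral\<^sup>L lborel (\<Psi> (truncate n f) (truncate n g) (truncate n h)))) \<longlonglongrightarrow> cmod (integral\<^sup>L lborel (\<Psi> f g h))"
      by (rule tendsto_norm)
    then have "cmod (integral\<^sup>L lborel (\<Psi> f g h)) \<le> ?b"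
      using trunc by (intro LIMSEQ_le_const2) auto
    then show ?thesis by (simp add: \<Psi>_def)
  next
    case False
    \<comment> \<open>A non-integrable integrand has integral 0 by convention.\<close>
    then show ?thesis using b by (simp add: \<Psi>_def not_integrable_integral_eq)
  qed
qed

lemma L2_dilation:
  assumes "f \<in> L2" "c \<noteq> 0"
  shows "(\<lambda>x. f (c * x)) \<in> L2" "L2norm (\<lambda>x. f (c * x)) = L2norm f / sqrt \<bar>c\<bar>"
proof -
  have [measurable]: "f \<in> borel_measurable borel" and i: "integrable lborel (\<lambda>t. (cmod (f t))\<^sup>2)"
    using assms by (auto simp: L2_def)
  show "(\<lambda>x. f (c * x)) \<in> L2"
    using lborel_integrable_real_affine[OF i assms(2), of 0] by (simp add: L2_def)
  show "L2norm (\<lambda>x. f (c * x)) = L2norm f / sqrt \<bar>c\<bar>"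
    unfolding L2norm_def using lborel_integral_real_affine[OF assms(2), of "\<lambda>t. (cmod (f t))\<^sup>2" 0] assms(2)
    by (simp add: real_sqrt_mult)
qed

section \<open>Linear forms on the plane\<close>

lemma linear_R2_coords:
  assumes "linear (p :: R2 \<Rightarrow> real)"
  shows "p z = p (1,0) * fst z + p (0,1) * snd z"
proof -
  have "p (fst z *\<^sub>R (1,0) + snd z *\<^sub>R (0,1)) = fst z *\<^sub>R p (1,0) + snd z *\<^sub>R p (0,1)"
    by (simp only: linear_add[OF assms] linear_scale[OF assms])
  moreover have "fst z *\<^sub>R (1,0) + snd z *\<^sub>R (0,1) = z" by (simp add: prod_eq_iff)
  ultimately show ?thesis by simp
qed

text \<open>A common nonzero kernel vector makes the 2 by 2 coefficient determinant vanish (Cramer).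
  Cross-multiplied rows then give linear relations, which force the coefficients of \<open>p\<close>
  to be zero and thereby contradict independence once more.\<close>

lemma lin_indep2_kernel:
  assumes p: "linear p" and q: "linear q" and ind: "lin_indep2 p q" and v: "v \<noteq> 0" "q v = 0"
  shows "p v \<noteq> 0"
proof
  assume pv: "p v = 0"
  define a b c d where "a = p (1,0)" and "b = p (0,1)" and "c = q (1,0)" and "d = q (0,1)"
  have P: "p z = a * fst z + b * snd z" and Q: "q z = c * fst z + d * snd z" for z
    unfolding a_def b_def c_def d_def by (rule linear_R2_coords[OF p] linear_R2_coords[OF q])+
  have "(a * d - b * c) * fst v = d * p v - b * q v" "(a * d - b * c) * snd v = a * q v - c * p v"
    unfolding P Q by (simp_all add: algebra_simps)
  then have det: "a * d - b * c = 0" using pv v by (auto simp: prod_eq_iff)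
  have "c * p z + (- a) * q z = 0" "d * p z + (- b) * q z = 0" for z
  proof -
    have "c * p z + (- a) * q z = - (a * d - b * c) * snd z" "d * p z + (- b) * q z = (a * d - b * c) * fst z"
      unfolding P Q by (simp_all add: algebra_simps)
    then show "c * p z + (- a) * q z = 0" "d * p z + (- b) * q z = 0" unfolding det by simp_all
  qed
  then have "a = 0" "b = 0" using ind unfolding lin_indep2_def by (metis neg_equal_0_iff_equal)+
  then have "1 * p z + 0 * q z = 0" for z by (simp add: P)
  then show False using ind unfolding lin_indep2_def by (metis one_neq_zero)
qed

text \<open>The kernel of a nonzero form on the plane is a line; as \<open>v\<close> is a unit
  vector, the factor is the inner product of \<open>u\<close> and \<open>v\<close>.\<close>

lemma linear_kernel_line:
  fixes p :: "R2 \<Rightarrow> real"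
  assumes p: "linear p" "p w \<noteq> 0" and u: "p u = 0" and v: "p v = 0" "norm v = 1"
  shows "\<exists>c. u = c *\<^sub>R v"
proof -
  define a b where "a = p (1,0)" and "b = p (0,1)"
  have P: "p z = a * fst z + b * snd z" for z
    unfolding a_def b_def by (rule linear_R2_coords[OF p(1)])
  have ab: "a \<noteq> 0 \<or> b \<noteq> 0" using p(2) by (auto simp: P)
  have "a * (fst u * snd v - snd u * fst v) = snd v * p u - snd u * p v"
    "b * (fst u * snd v - snd u * fst v) = fst u * p v - fst v * p u"
    unfolding P by (simp_all add: algebra_simps)
  then have det: "fst u * snd v = snd u * fst v" using ab u v by auto
  have n: "(fst v)\<^sup>2 + (snd v)\<^sup>2 = 1" using v(2) by (simp add: norm_prod_def)
  have "(fst u * fst v + snd u * snd v) * fst v = fst u * ((fst v)\<^sup>2 + (snd v)\<^sup>2) + snd v * (snd u * fst v - fst u * snd v)"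
    "(fst u * fst v + snd u * snd v) * snd v = snd u * ((fst v)\<^sup>2 + (snd v)\<^sup>2) - fst v * (snd u * fst v - fst u * snd v)"
    by (simp_all add: power2_eq_square algebra_simps)
  then have "u = (fst u * fst v + snd u * snd v) *\<^sub>R v" by (simp add: prod_eq_iff det n)
  then show ?thesis by blast
qed

lemma lin_indep2_sym: "lin_indep2 p q \<Longrightarrow> lin_indep2 q p"
  unfolding lin_indep2_def by (metis add.commute)

text \<open>\<open>S\<close> is arbitrary outside \<open>U\<close>, so continuity is glued from two
  open sets covering the plane: \<open>U\<close>, and the complement of the support, where the
  product is zero.\<close>

lemma continuous_cutoff_oscillation:
  fixes a :: "R2 \<Rightarrow> complex" and S :: "R2 \<Rightarrow> real"
  assumes a: "Cc_inf a" and U: "supp a \<subseteq> U" and S: "smooth_on U S"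
  shows "continuous_on UNIV (\<lambda>z. exp (\<i> * of_real (lam * S z)) * a z)" (is "continuous_on _ ?A")
proof -
  have "continuous_on U S" using smooth_onD(1)[OF S, of "[]"] by simp
  moreover have "continuous_on U a"
    using a smooth_onD(1)[of UNIV a "[]"] continuous_on_subset by (auto simp: Cc_inf_def)
  ultimately have 1: "continuous_on U ?A" by (intro continuous_intros)
  have o: "open (- supp a)" by (simp add: supp_def open_Compl)
  have "continuous_on (- supp a) (\<lambda>_. 0 :: complex)" by (rule continuous_on_const)
  then have 2: "continuous_on (- supp a) ?A"
    using dirDs_outside_supp[of _ a "[]"] by (subst continuous_on_cong[OF refl, of _ _ "\<lambda>_. 0"]) auto
  from continuous_on_open_Un[OF smooth_onD(3)[OF S] o 1 2] show ?thesis
    using U by (metis Compl_partition2 Un_UNIV_left sup.absorb_iff2 sup_assoc sup_commute)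
qed

theorem theorem1p3:
  fixes p1 p2 p3 :: "R2 \<Rightarrow> real" and v1 v2 v3 :: R2
    and a :: "R2 \<Rightarrow> complex" and S :: "R2 \<Rightarrow> real" and U :: "R2 set"
  assumes "linear p1" "linear p2" "linear p3"
    and "lin_indep2 p1 p2" "lin_indep2 p1 p3" "lin_indep2 p2 p3"
    and "norm v1 = 1" "norm v2 = 1" "norm v3 = 1"
    and "p1 v1 = 0" "p2 v2 = 0" "p3 v3 = 0"
    and "Cc_inf a"
    and "convex hull (supp a) \<subseteq> U" "smooth_on U S"
    and "\<forall>z\<in>convex hull (supp a). \<bar>dirD v1 (dirD v2 (dirD v3 S)) z\<bar> \<ge> 1"
  shows "\<exists>C. \<forall>lam f1 f2 f3. lam \<noteq> 0 \<longrightarrow> f1 \<in> L2 \<longrightarrow> f2 \<in> L2 \<longrightarrow> f3 \<in> L2 \<longrightarrow>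
           cmod (Lambda lam S a p1 p2 p3 f1 f2 f3)
             \<le> C * \<bar>lam\<bar> powr (-1/6) * L2norm f1 * L2norm f2 * L2norm f3"
proof -
  have v: "v1 \<noteq> 0" "v2 \<noteq> 0" "v3 \<noteq> 0" using assms(7-9) by auto
  have nz: "p1 v2 \<noteq> 0" "p1 v3 \<noteq> 0" "p2 v3 \<noteq> 0" "p3 v2 \<noteq> 0"
    using lin_indep2_kernel[OF assms(1,2,4) v(2) assms(11)] lin_indep2_kernel[OF assms(1,3,5) v(3) assms(12)]
      lin_indep2_kernel[OF assms(2,3,6) v(3) assms(12)]
      lin_indep2_kernel[OF assms(3,2) lin_indep2_sym[OF assms(6)] v(2) assms(11)] by auto
  \<comment> \<open>Basis from the kernels of \<open>p2\<close> and \<open>p3\<close>, normalised so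
    that \<open>p1\<close> becomes x + y. Then \<open>p2\<close> depends on y only and
    \<open>p3\<close> on x only, and \<open>w2 - w3\<close> lies in the kernel of
    \<open>p1\<close>.\<close>
  define c2 c3 w2 w3 where "c2 = 1 / p1 v2" and "c3 = 1 / p1 v3" and "w2 = c2 *\<^sub>R v2" and "w3 = c3 *\<^sub>R v3"
  define \<alpha> \<beta> where "\<alpha> = p3 w2" and "\<beta> = p2 w3"
  note lin = linear_scale[OF assms(1)] linear_scale[OF assms(2)] linear_scale[OF assms(3)]
    linear_add[OF assms(1)] linear_add[OF assms(2)] linear_add[OF assms(3)]
  have c: "c2 \<noteq> 0" "c3 \<noteq> 0" using nz by (auto simp: c2_def c3_def)
  have pw: "p1 w2 = 1" "p1 w3 = 1" "p2 w2 = 0" "p3 w3 = 0"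
    using nz assms(11,12) by (auto simp: w2_def w3_def c2_def c3_def lin)
  have \<alpha>: "\<alpha> \<noteq> 0" and \<beta>: "\<beta> \<noteq> 0" using nz c by (auto simp: \<alpha>_def \<beta>_def w2_def w3_def lin)
  have pT: "p1 (x *\<^sub>R w2 + y *\<^sub>R w3) = x + y" "p2 (x *\<^sub>R w2 + y *\<^sub>R w3) = \<beta> * y"
    "p3 (x *\<^sub>R w2 + y *\<^sub>R w3) = \<alpha> * x" for x y
    by (simp_all add: lin pw \<alpha>_def \<beta>_def)
  obtain c1 where c1: "w2 - w3 = c1 *\<^sub>R v1"
    using linear_kernel_line[OF assms(1), of w2 "w2 - w3" v1] assms(7,10) pw linear_diff[OF assms(1)] by auto
  \<comment> \<open>Otherwise \<open>w2 = w3\<close>, and \<open>p2\<close> would vanish on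
    \<open>w3\<close>.\<close>
  have "c1 \<noteq> 0" using c1 pw(3) \<beta> by (auto simp: \<beta>_def)
  define d where "d = fst w2 * snd w3 - snd w2 * fst w3"
  have d: "d \<noteq> 0"
  proof
    assume "d = 0"
    have P: "p2 z = p2 (1,0) * fst z + p2 (0,1) * snd z" for z by (rule linear_R2_coords[OF assms(2)])
    have "fst w2 * p2 w3 = fst w3 * p2 w2 + p2 (0,1) * d" "snd w2 * p2 w3 = snd w3 * p2 w2 - p2 (1,0) * d"
      unfolding P[of w2] P[of w3] d_def by (simp_all add: algebra_simps)
    then have "w2 = 0" using \<open>d = 0\<close> pw(3) \<beta> by (auto simp: \<beta>_def prod_eq_iff)
    then show False using pw(1) linear_0[OF assms(1)] by simp
  qed
  define K where "K = convex hull (supp a)"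
  have supp: "supp a \<subseteq> K" "z \<in> K" if "a z \<noteq> 0" for z
    using that closure_subset[of "{x. a x \<noteq> 0}"] hull_subset[of "supp a" convex] by (auto simp: K_def supp_def)
  have "compact K" using assms(13) by (auto simp: K_def Cc_inf_def compact_convex_hull)
  then obtain R where R: "\<And>z. z \<in> K \<Longrightarrow> norm z \<le> R"
    using compact_imp_bounded bounded_iff by metis
  obtain B2 B3 where B: "B2 > 0" "\<And>z. norm (p2 z) \<le> B2 * norm z" "B3 > 0" "\<And>z. norm (p3 z) \<le> B3 * norm z"
    using linear_bounded_pos[OF assms(2)] linear_bounded_pos[OF assms(3)] by metis
  \<comment> \<open>y is recovered from \<open>p2\<close> as \<open>p2 z / \<beta>\<close>, which is
    bounded on \<open>K\<close>. The absolute value guards against a negative \<open>R\<close> when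
    \<open>K\<close> is empty.\<close>
  define r where "r = B2 * \<bar>R\<bar> / \<bar>\<beta>\<bar>"
  define r' where "r' = B3 * \<bar>R\<bar> / \<bar>\<alpha>\<bar>"
  have r0: "r \<ge> 0" using B by (simp add: r_def)
  have rb: "\<bar>y\<bar> \<le> r" "\<bar>x\<bar> \<le> r'" if "x *\<^sub>R w2 + y *\<^sub>R w3 \<in> K" for x y
  proof -
    let ?z = "x *\<^sub>R w2 + y *\<^sub>R w3"
    have n: "norm ?z \<le> \<bar>R\<bar>" using R[OF that] by linarith
    have "\<bar>\<beta> * y\<bar> \<le> B2 * \<bar>R\<bar>" using order_trans[OF B(2)[of ?z] mult_left_mono[OF n]] B(1) unfolding pT by simp
    then show "\<bar>y\<bar> \<le> r" using \<beta> by (simp add: r_def abs_mult field_simps)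
    have "\<bar>\<alpha> * x\<bar> \<le> B3 * \<bar>R\<bar>" using order_trans[OF B(4)[of ?z] mult_left_mono[OF n]] B(3) unfolding pT by simp
    then show "\<bar>x\<bar> \<le> r'" using \<alpha> by (simp add: r'_def abs_mult field_simps)
  qed
  define A where "A = (\<lambda>lam (x, y). exp (\<i> * of_real (lam * S (x *\<^sub>R w2 + y *\<^sub>R w3))) * a (x *\<^sub>R w2 + y *\<^sub>R w3))"
  have "\<exists>C\<ge>0. \<forall>lam t x s. cmod (\<integral>y. A lam (x,y) * cnj (A lam (x+t,y-t)) *
        cnj (A lam (x+s,y) * cnj (A lam (x+s+t,y-t))) \<partial>lborel) \<le> C / (1 + (\<bar>lam\<bar> * \<bar>t\<bar> * s)\<^sup>2)"
    unfolding A_def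
    by (rule correlation_kernel_bound[OF assms(13-16) w2_def w3_def c1 \<open>c1 \<noteq> 0\<close> c r0 rb(1)[unfolded K_def]])
  then obtain C where C: "C \<ge> 0" and kernel: "\<And>lam t x s. cmod (\<integral>y. A lam (x,y) * cnj (A lam (x+t,y-t)) *
        cnj (A lam (x+s,y) * cnj (A lam (x+s+t,y-t))) \<partial>lborel) \<le> C / (1 + (\<bar>lam\<bar> * \<bar>t\<bar> * s)\<^sup>2)"
    by blast
  obtain M where M: "\<And>z. cmod (a z) \<le> M" using Cc_inf_dirDs_bounded[OF assms(13), of "[]"] by auto
  have AM: "cmod (A lam p) \<le> M" for lam p using M by (auto simp: A_def norm_mult split: prod.split)
  have cont: "continuous_on UNIV (\<lambda>z. exp (\<i> * of_real (lam * S z)) * a z)" for lam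
    using continuous_cutoff_oscillation[OF assms(13) _ assms(15)] assms(14) hull_subset[of "supp a" convex] by blast
  have A: "bbs (A lam)" for lam
  proof (rule bbs_pairI[where M=M and R=r' and R'=r])
    have "continuous_on UNIV (\<lambda>p :: real \<times> real. fst p *\<^sub>R w2 + snd p *\<^sub>R w3)" by (intro continuous_intros)
    from continuous_on_compose2[OF cont[of lam] this] have "continuous_on UNIV (A lam)"
      by (simp add: A_def case_prod_beta')
    then show "A lam \<in> borel_measurable (borel \<Otimes>\<^sub>M borel)"
      by (simp add: borel_prod borel_measurable_continuous_onI)
    show "cmod (A lam (x, y)) \<le> M" for x y by (rule AM)
    show "\<bar>x\<bar> \<le> r' \<and> \<bar>y\<bar> \<le> r" if "A lam (x, y) \<noteq> 0" for x y
    proof -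
      have "a (x *\<^sub>R w2 + y *\<^sub>R w3) \<noteq> 0" using that by (simp add: A_def)
      from supp(2)[OF this] show ?thesis using rb by blast
    qed
  qed
  \<comment> \<open>\<open>\<bar>d\<bar>\<close> is the Jacobian; the roots in the denominator come
    from the dilations by \<open>\<alpha>\<close> in \<open>f3\<close> and by \<open>\<beta>\<close>
    in \<open>f2\<close>.\<close>
  define C' where "C' = \<bar>d\<bar> * sqrt (2 * M\<^sup>2 + sqrt (C * pi)) / (sqrt \<bar>\<alpha>\<bar> * sqrt \<bar>\<beta>\<bar>)"
  show ?thesis
  proof (intro exI[of _ C'] allI impI)
    fix lam :: real and f1 f2 f3 assume lam: "lam \<noteq> 0" and f: "f1 \<in> L2" "f2 \<in> L2" "f3 \<in> L2"
    have [measurable]: "f1 \<in> borel_measurable borel" "f2 \<in> borel_measurable borel" "f3 \<in> borel_measurable borel"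
      using f by (auto simp: L2_def)
    have [measurable]: "p1 \<in> borel_measurable borel" "p2 \<in> borel_measurable borel" "p3 \<in> borel_measurable borel"
      using assms(1-3) by (auto intro!: borel_measurable_continuous_onI linear_continuous_on simp: linear_conv_bounded_linear)
    have "(\<lambda>z. exp (\<i> * of_real (lam * S z)) * a z) \<in> borel_measurable borel"
      using cont by (rule borel_measurable_continuous_onI)
    then have meas: "(\<lambda>z. exp (\<i> * of_real (lam * S z)) * a z * f1 (p1 z) * f2 (p2 z) * f3 (p3 z)) \<in> borel_measurable borel"
      by (rule borel_measurable_times[OF borel_measurable_times[OF borel_measurable_times]]) measurable
    have "Lambda lam S a p1 p2 p3 f1 f2 f3 = \<bar>d\<bar> *\<^sub>R (\<integral>p. A lam p * f3 (\<alpha> * fst p) * f2 (\<beta> * snd p) * f1 (fst p + snd p) \<partial>lborel)"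
      unfolding Lambda_def d_def
      using d by (subst integral_linear_coordinates[OF meas, of w2 w3])
        (simp_all add: pT A_def d_def case_prod_beta' mult_ac)
    then have "cmod (Lambda lam S a p1 p2 p3 f1 f2 f3) =
        \<bar>d\<bar> * cmod (\<integral>p. A lam p * f3 (\<alpha> * fst p) * f2 (\<beta> * snd p) * f1 (fst p + snd p) \<partial>lborel)"
      by simp
    also have "\<dots> \<le> \<bar>d\<bar> * (sqrt (2 * M\<^sup>2 + sqrt (C * pi)) * \<bar>lam\<bar> powr (-1/6) *
        L2norm (\<lambda>x. f3 (\<alpha> * x)) * L2norm (\<lambda>x. f2 (\<beta> * x)) * L2norm f1)"
      by (intro mult_left_mono trilinear_form_L2_bound[OF A L2_dilation(1)[OF f(3) \<alpha>] L2_dilation(1)[OF f(2) \<beta>] f(1) C _ AM kernel])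
        (use lam in auto)
    also have "\<dots> = C' * \<bar>lam\<bar> powr (-1/6) * L2norm f1 * L2norm f2 * L2norm f3"
      by (simp add: C'_def L2_dilation(2)[OF f(3) \<alpha>] L2_dilation(2)[OF f(2) \<beta>])
    finally show "cmod (Lambda lam S a p1 p2 p3 f1 f2 f3)
             \<le> C' * \<bar>lam\<bar> powr (-1/6) * L2norm f1 * L2norm f2 * L2norm f3" .
  qed
qed

end
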